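(* Let $G$ be a graph with $v(G)\ge 3$. If $F$ is an elementary graph on $v(G)$ vertices other than a cycle, then the number $\left[\begin{array}{c} G \\ F \end{array}\right]$ of subgraphs of $G$ isomorphic to $F$ is reconstructible from $\mathcal{PD}(G)$. Therefore, if there is a vertex of degree $1$ in $G$, then the characteristic polynomial $P(G;\lambda)$ is reconstructible from the complete polynomial deck $\mathcal{PD}(G)$.
   Context: All graphs are finite and simple; $v(G)$ is the number of vertices. $P(G;\lambda)$ is the characteristic polynomial $\det(\lambda I-M)$ of the adjacency matrix $M$ of $G$. The complete polynomial deck $\mathcal{PD}(G)$ is the multiset of the polynomials $P(K;\lambda)$, where $K$ ranges over the proper induced subgraphs of $G$, i.e. over the $G-S$ with $\emptyset\ne S\subseteq VG$ (one entry for each $S$). A graph is elementary if each of its components is either a single edge $K_2$ or a cycle $C_r$ with $r>2$. The number $\left[\begin{array}{c} G \\ F \end{array}\right]$ counts all (not necessarily induced) subgraphs of $G$ isomorphic to $F$. A quantity attached to a graph $G$ is reconstructible from $\mathcal{PD}(G)$ if it can be computed from $\mathcal{PD}(G)$, i.e. it takes the same value on $G$ and on any graph $G'$ with $\mathcal{PD}(G')=\mathcal{PD}(G)$. *)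

theory Defs
  imports
    "Graph_Theory.Graph_Theory"
    "Jordan_Normal_Form.Char_Poly"
    "HOL-Library.Multiset"
begin

text \<open>
  A finite simple graph is a digraph satisfying the predicate \<open>graph\<close> of Graph_Theory
  (finite, symmetric, without loops and parallel arcs): an undirected edge \<open>uv\<close> is represented
  by the two arcs from \<open>u\<close> to \<open>v\<close> and from \<open>v\<close> to \<open>u\<close>.  For such graphs the degree of \<open>v\<close> is
  \<open>out_degree G v\<close>, and the connected components are the strongly connected components
  \<open>pre_digraph.sccs G\<close>.
\<close>

definition adjacency_matrix :: "('a, 'b) pre_digraph \<Rightarrow> 'a list \<Rightarrow> int mat" where
  "adjacency_matrix G vs =
     mat (length vs) (length vs) (\<lambda>(i, j). if (vs ! i, vs ! j) \<in> arcs_ends G then 1 else 0)"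

text \<open>
  The vertices are listed in an arbitrary order; another order conjugates the adjacency matrix
  by a permutation matrix and so gives the same characteristic polynomial.
  For the graph without vertices the polynomial is \<open>1\<close>.
\<close>

definition graph_char_poly :: "('a, 'b) pre_digraph \<Rightarrow> int poly" where
  "graph_char_poly G =
     char_poly (adjacency_matrix G (SOME vs. distinct vs \<and> set vs = verts G))"

definition complete_poly_deck :: "('a, 'b) pre_digraph \<Rightarrow> int poly multiset" where
  "complete_poly_deck G =
     image_mset (\<lambda>S. graph_char_poly (G \<restriction> (verts G - S))) (mset_set {S. S \<noteq> {} \<and> S \<subseteq> verts G})"

definition cycle_graph :: "nat \<Rightarrow> ('a, 'b) pre_digraph \<Rightarrow> bool" where
  "cycle_graph r C \<longleftrightarrow> graph C \<and> r > 2 \<and>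
     (\<exists>f. bij_betw f {..<r} (verts C) \<and>
        arcs_ends C = (\<Union>i<r. {(f i, f (Suc i mod r)), (f (Suc i mod r), f i)}))"

definition elementary_graph :: "('a, 'b) pre_digraph \<Rightarrow> bool" where
  "elementary_graph F \<longleftrightarrow> graph F \<and>
     (\<forall>C \<in> pre_digraph.sccs F. complete_digraph 2 C \<or> (\<exists>r. cycle_graph r C))"

text \<open>
  The relation \<open>subgraph H G\<close> of Graph_Theory allows \<open>H\<close> to contain only one of the two arcs of an
  edge; the condition \<open>graph H\<close> leaves the subgraphs in the undirected sense.  As \<open>subgraph H G\<close>
  also forces \<open>H\<close> and \<open>G\<close> to have the same \<open>tail\<close> and \<open>head\<close> functions, \<open>H\<close> is determined by its
  vertex and arc sets, so that each subgraph is counted once.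
\<close>

definition subgraph_count :: "('a, 'b) pre_digraph \<Rightarrow> ('c, 'd) pre_digraph \<Rightarrow> nat" where
  "subgraph_count G F = card {H. subgraph H G \<and> graph H \<and> digraph_iso H F}"

end

theory Submission
  imports Defs
begin

text \<open>
  Only the principal minors of sizes below \<open>n\<close> and their products over the induced subgraphs can be
  read off the deck.  Inclusion-exclusion over the vertex subsets turns such products into sums over
  coverings of the vertex set; when the sizes of the covering sets add up to \<open>n\<close>, the coverings are
  partitions, and the sum becomes a sum over the permutations \<open>p\<close> of the vertices, each weighted by
  its sign, by the product of the entries \<open>A x (p x)\<close>, and by the number of \<open>p\<close>-stable partitions of
  the given sizes.  Taking the orbit sizes of a permutation \<open>r\<close>, this number is nonzero only if
  \<open>p\<close> is conjugate to \<open>r\<close> or has more orbits than \<open>r\<close>.  So the system is triangular in the number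
  of orbits, and for every \<open>r\<close> with at least two orbits the sum of the weights over the conjugacy
  class of \<open>r\<close> is reconstructible.

  An elementary graph \<open>F\<close> consists of the edges \<open>{x, r x}\<close> of a permutation \<open>r\<close>, with one orbit for
  each component, and the sum for \<open>r\<close> counts the embeddings of \<open>F\<close> into the graph.  A graph with a vertex
  of degree 1 has no Hamiltonian cycle, so that its determinant involves no permutation with a
  single orbit; the other coefficients of its characteristic polynomial are always reconstructible,
  and so are the degrees.
\<close>

section \<open>Principal minors\<close>

text \<open>The Leibniz expansion of the principal minor of \<open>A\<close> on \<open>X\<close>.
  Indexing by a set instead of a list lets minors on different vertex sets be multiplied and
  compared without choosing orders.\<close>

definition pdet :: "('a \<Rightarrow> 'a \<Rightarrow> 'b::comm_ring_1) \<Rightarrow> 'a set \<Rightarrow> 'b" where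
  "pdet A X = (\<Sum>p | p permutes X. of_int (sign p) * (\<Prod>x\<in>X. A x (p x)))"

text \<open>This is det(lambda I - A[X]) expanded by principal minors: the coefficient
  \<open>r\<close> places below the top is \<open>(-1) ^ r\<close> times the sum of the minors of
  size \<open>r\<close>.\<close>

definition pchar_poly :: "('a \<Rightarrow> 'a \<Rightarrow> 'b::comm_ring_1) \<Rightarrow> 'a set \<Rightarrow> 'b poly" where
  "pchar_poly A X = (\<Sum>Y\<in>Pow X. monom ((-1) ^ card Y * pdet A Y) (card X - card Y))"

lemma pdet_reindex:
  assumes "finite X" and h: "bij_betw h X Y"
  shows "pdet (\<lambda>x y. A (h x) (h y)) X = pdet A Y"
proof -
  let ?m = "map_permutation X h"
  have inj: "inj_on h X" and im: "h ` X = Y" using h by (auto simp: bij_betw_def)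
  have inj': "inj_on (inv_into X h) Y" and im': "inv_into X h ` Y = X"
    using bij_betw_inv_into[OF h] by (auto simp: bij_betw_def)
  show ?thesis unfolding pdet_def
  proof (rule sum.reindex_bij_witness[where j = ?m and i = "map_permutation Y (inv_into X h)"])
    fix p assume "p \<in> {p. p permutes X}"
    then have p: "p permutes X" by simp
    show "map_permutation Y (inv_into X h) (?m p) = p"
      by (rule map_permutation_compose_inv[OF h p]) (simp add: inj inv_into_f_f)
    show "?m p \<in> {p. p permutes Y}"
      using map_permutation_permutes[OF h p] by simp
    have "(\<Prod>y\<in>Y. A y (?m p y)) = (\<Prod>x\<in>X. A (h x) (?m p (h x)))"
      by (rule prod.reindex_bij_betw[OF h, symmetric])
    also have "\<dots> = (\<Prod>x\<in>X. A (h x) (h (p x)))"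
      by (rule prod.cong) (simp_all add: map_permutation_apply[OF inj])
    finally show "of_int (sign (?m p)) * (\<Prod>y\<in>Y. A y (?m p y))
        = of_int (sign p) * (\<Prod>x\<in>X. A (h x) (h (p x)))"
      using sign_map_permutation[OF inj p assms(1)] by simp
  next
    fix p assume "p \<in> {p. p permutes Y}"
    then have p: "p permutes Y" by simp
    show "?m (map_permutation Y (inv_into X h) p) = p"
      by (rule map_permutation_compose_inv[OF bij_betw_inv_into[OF h] p])
        (simp add: im f_inv_into_f)
    show "map_permutation Y (inv_into X h) p \<in> {p. p permutes X}"
      using map_permutation_permutes[OF bij_betw_inv_into[OF h] p] by simp
  qed
qed

lemma pdet_cong:
  assumes "\<And>x y. x \<in> X \<Longrightarrow> y \<in> X \<Longrightarrow> A x y = B x y"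
  shows "pdet A X = pdet B X"
  unfolding pdet_def
proof (rule sum.cong[OF refl])
  fix p assume "p \<in> {p. p permutes X}"
  then have "(\<Prod>x\<in>X. A x (p x)) = (\<Prod>x\<in>X. B x (p x))"
    by (intro prod.cong) (auto simp: assms permutes_in_image)
  then show "of_int (sign p) * (\<Prod>x\<in>X. A x (p x)) = of_int (sign p) * (\<Prod>x\<in>X. B x (p x))"
    by simp
qed

lemma pchar_poly_reindex:
  assumes "finite X" and h: "bij_betw h X Y"
  shows "pchar_poly (\<lambda>x y. A (h x) (h y)) X = pchar_poly A Y"
proof -
  have inj: "inj_on h X" using h by (auto simp: bij_betw_def)
  show ?thesis unfolding pchar_poly_def
    unfolding sum.reindex_bij_betw[OF bij_betw_Pow[OF h], symmetric]
  proof -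
    show "(\<Sum>Z\<in>Pow X. monom ((-1) ^ card Z * pdet (\<lambda>x y. A (h x) (h y)) Z) (card X - card Z))
      = (\<Sum>Z\<in>Pow X. monom ((-1) ^ card (h ` Z) * pdet A (h ` Z)) (card Y - card (h ` Z)))"
    proof (rule sum.cong, simp)
      fix Z assume "Z \<in> Pow X"
      then have Z: "Z \<subseteq> X" by simp
      have "bij_betw h Z (h ` Z)" using Z inj by (meson inj_on_imp_bij_betw inj_on_subset)
      then have "pdet (\<lambda>x y. A (h x) (h y)) Z = pdet A (h ` Z)"
        using pdet_reindex finite_subset[OF Z assms(1)] by blast
      moreover have "card (h ` Z) = card Z" using Z inj by (meson card_image inj_on_subset)
      moreover have "card Y = card X" using h by (metis bij_betw_same_card)
      ultimately show "monom ((-1) ^ card Z * pdet (\<lambda>x y. A (h x) (h y)) Z) (card X - card Z)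
        = monom ((-1) ^ card (h ` Z) * pdet A (h ` Z)) (card Y - card (h ` Z))" by simp
    qed
  qed
qed

text \<open>Expand each product over the set \<open>Y\<close> of rows in which the entry of
  \<open>- A\<close> is taken. The other rows contribute the variable only where \<open>p\<close>
  fixes the point, so exactly the permutations of \<open>Y\<close> survive and give the minor on
  \<open>Y\<close>.\<close>

lemma pdet_char_matrix:
  assumes "finite X"
  shows "pdet (\<lambda>x y. [:- A x y:] + (if x = y then [:0, 1:] else 0)) X = pchar_poly A X"
proof -
  let ?d = "\<lambda>x y. if x = y then [:0, 1:] else 0 :: 'b poly"
  have "pdet (\<lambda>x y. [:- A x y:] + ?d x y) X
     = (\<Sum>p | p permutes X. \<Sum>Y\<in>Pow X. of_int (sign p) *
          ((\<Prod>x\<in>Y. [:- A x (p x):]) * (\<Prod>x\<in>X - Y. ?d x (p x))))"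
    unfolding pdet_def prod_add[OF assms] by (simp add: sum_distrib_left)
  also have "\<dots> = (\<Sum>Y\<in>Pow X. \<Sum>p | p permutes X. of_int (sign p) *
          ((\<Prod>x\<in>Y. [:- A x (p x):]) * (\<Prod>x\<in>X - Y. ?d x (p x))))"
    by (rule sum.swap)
  also have "\<dots> = (\<Sum>Y\<in>Pow X. monom ((-1) ^ card Y * pdet A Y) (card X - card Y))"
  proof (rule sum.cong, simp)
    fix Y assume "Y \<in> Pow X"
    then have Y: "Y \<subseteq> X" and fin: "finite Y" using assms finite_subset by auto
    have "(\<Sum>p | p permutes X. of_int (sign p) *
          ((\<Prod>x\<in>Y. [:- A x (p x):]) * (\<Prod>x\<in>X - Y. ?d x (p x))))
      = (\<Sum>p | p permutes Y. [:of_int (sign p) * ((-1) ^ card Y * (\<Prod>x\<in>Y. A x (p x))):]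
            * monom 1 (card X - card Y))"
    proof (rule sum.mono_neutral_cong_right)
      show "finite {p. p permutes X}" using assms by (rule finite_permutations)
      show "{p. p permutes Y} \<subseteq> {p. p permutes X}" using Y by (auto intro: permutes_subset)
      show "\<forall>p\<in>{p. p permutes X} - {p. p permutes Y}. of_int (sign p) *
          ((\<Prod>x\<in>Y. [:- A x (p x):]) * (\<Prod>x\<in>X - Y. ?d x (p x))) = 0"
      proof
        fix p assume p: "p \<in> {p. p permutes X} - {p. p permutes Y}"
        then obtain x where "x \<in> X - Y" "p x \<noteq> x"
          using permutes_superset[of p X Y] by auto
        then have "(\<Prod>x\<in>X - Y. ?d x (p x)) = 0"
          using assms by (intro prod_zero) force+
        then show "of_int (sign p) *
          ((\<Prod>x\<in>Y. [:- A x (p x):]) * (\<Prod>x\<in>X - Y. ?d x (p x))) = 0" by simp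
      qed
      fix p assume "p \<in> {p. p permutes Y}"
      then have p: "p permutes Y" by simp
      have "(\<Prod>x\<in>X - Y. ?d x (p x)) = (\<Prod>x\<in>X - Y. monom 1 1)"
        using p by (intro prod.cong) (auto simp: permutes_not_in monom_altdef)
      also have "\<dots> = monom 1 (card X - card Y)"
        using Y fin by (simp add: monom_power card_Diff_subset)
      finally have 1: "(\<Prod>x\<in>X - Y. ?d x (p x)) = monom 1 (card X - card Y)" .
      have "(\<Prod>x\<in>Y. [:- A x (p x):]) = [:\<Prod>x\<in>Y. - A x (p x):]"
        using fin by (induction Y) (auto simp: mult.commute)
      then have 2: "(\<Prod>x\<in>Y. [:- A x (p x):]) = [:(-1) ^ card Y * (\<Prod>x\<in>Y. A x (p x)):]"
        by (simp add: prod_uminus)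
      show "of_int (sign p) *
          ((\<Prod>x\<in>Y. [:- A x (p x):]) * (\<Prod>x\<in>X - Y. ?d x (p x)))
        = [:of_int (sign p) * ((-1) ^ card Y * (\<Prod>x\<in>Y. A x (p x))):] * monom 1 (card X - card Y)"
        unfolding 1 2 by (simp add: of_int_poly smult_monom)
    qed
    also have "\<dots> = monom ((-1) ^ card Y * pdet A Y) (card X - card Y)"
      unfolding pdet_def by (simp add: smult_monom sum_distrib_left monom_sum mult.left_commute)
    finally show "(\<Sum>p | p permutes X. of_int (sign p) *
          ((\<Prod>x\<in>Y. [:- A x (p x):]) * (\<Prod>x\<in>X - Y. ?d x (p x))))
      = monom ((-1) ^ card Y * pdet A Y) (card X - card Y)" .
  qed
  finally show ?thesis by (simp add: pchar_poly_def)
qed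

lemma char_poly_eq_pchar_poly:
  assumes "distinct vs"
  shows "char_poly (mat (length vs) (length vs) (\<lambda>(i, j). A (vs ! i) (vs ! j)))
    = pchar_poly A (set vs)"
proof -
  let ?n = "length vs"
  let ?M = "mat ?n ?n (\<lambda>(i, j). A (vs ! i) (vs ! j))"
  let ?B = "\<lambda>x y. [:- A x y:] + (if x = y then [:0, 1:] else 0)"
  have h: "bij_betw ((!) vs) {0..<?n} (set vs)"
    using bij_betw_nth[OF assms, of "{0..<?n}" "set vs"] by (simp add: atLeast0LessThan)
  have c: "char_poly_matrix ?M \<in> carrier_mat ?n ?n" by simp
  have "char_poly ?M = (\<Sum>p | p permutes {0..<?n}. of_int (sign p) *
      (\<Prod>i\<in>{0..<?n}. char_poly_matrix ?M $$ (i, p i)))"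
    unfolding char_poly_def det_def'[OF c] ..
  also have "\<dots> = pdet (\<lambda>i j. ?B (vs ! i) (vs ! j)) {0..<?n}"
    unfolding pdet_def
  proof (intro sum.cong refl arg_cong2[where f = "(*)"] prod.cong)
    fix p i assume "p \<in> {p. p permutes {0..<?n}}" "i \<in> {0..<?n}"
    then have "i < ?n" "p i < ?n" using permutes_in_image[of p "{0..<?n}" i] by auto
    \<comment> \<open>\<open>vs\<close> is distinct, so indices agree exactly when vertices do, and
      both matrices have the variable in the same places.\<close>
    then show "char_poly_matrix ?M $$ (i, p i) = ?B (vs ! i) (vs ! p i)"
      using assms by (auto simp: char_poly_matrix_def nth_eq_iff_index_eq)
  qed
  also have "\<dots> = pdet ?B (set vs)" by (rule pdet_reindex) (use h in auto)
  also have "\<dots> = pchar_poly A (set vs)" by (rule pdet_char_matrix) simp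
  finally show ?thesis .
qed

section \<open>Minor sums as coefficients, and the information in the deck\<close>

definition minor_sum :: "('a \<Rightarrow> 'a \<Rightarrow> 'b::comm_ring_1) \<Rightarrow> nat \<Rightarrow> 'a set \<Rightarrow> 'b" where
  "minor_sum A r X = (\<Sum>Y | Y \<subseteq> X \<and> card Y = r. pdet A Y)"

text \<open>Recovers a minor sum from the polynomial alone, because the degree reveals the size of
  the set. The default 0 agrees with the empty sum that arises when \<open>r\<close> exceeds that
  size.\<close>

definition signed_coeff :: "nat \<Rightarrow> 'b::comm_ring_1 poly \<Rightarrow> 'b" where
  "signed_coeff r p = (if r \<le> degree p then (-1) ^ r * coeff p (degree p - r) else 0)"

text \<open>The cards are indexed by the sets that remain, and both matrices live on one vertex set,
  so that graphs on different vertex types can be compared after relabelling.\<close>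

definition same_deck ::
    "('a \<Rightarrow> 'a \<Rightarrow> 'b::comm_ring_1) \<Rightarrow> ('a \<Rightarrow> 'a \<Rightarrow> 'b) \<Rightarrow> 'a set \<Rightarrow> bool" where
  "same_deck A B V \<longleftrightarrow>
     image_mset (pchar_poly A) (mset_set {X. X \<subset> V}) = image_mset (pchar_poly B) (mset_set {X. X \<subset> V})"

lemma pdet_empty [simp]: "pdet A {} = 1"
  by (simp add: pdet_def)

lemma coeff_pchar_poly:
  assumes "finite X" and "r \<le> card X"
  shows "coeff (pchar_poly A X) (card X - r) = (-1) ^ r * minor_sum A r X"
proof -
  have "coeff (pchar_poly A X) (card X - r)
      = (\<Sum>Y\<in>Pow X. if card X - card Y = card X - r then (-1) ^ card Y * pdet A Y else 0)"
    by (simp add: pchar_poly_def coeff_sum)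
  also have "\<dots> = (\<Sum>Y | Y \<subseteq> X \<and> card Y = r. (-1) ^ r * pdet A Y)"
  proof (rule sum.mono_neutral_cong_right)
    show "\<forall>Y\<in>Pow X - {Y. Y \<subseteq> X \<and> card Y = r}.
        (if card X - card Y = card X - r then (-1) ^ card Y * pdet A Y else 0) = 0"
    proof
      fix Y assume Y: "Y \<in> Pow X - {Y. Y \<subseteq> X \<and> card Y = r}"
      \<comment> \<open>Neither \<open>card Y\<close> nor \<open>r\<close> exceeds
        \<open>card X\<close>, so equal truncated differences would force
        \<open>card Y = r\<close>.\<close>
      then have "card Y \<le> card X" using assms(1) by (auto intro: card_mono)
      then show "(if card X - card Y = card X - r then (-1) ^ card Y * pdet A Y else 0) = 0"
        using Y assms(2) by auto
    qed
  qed (use assms in auto)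
  finally show ?thesis by (simp add: minor_sum_def sum_distrib_left)
qed

lemma minor_sum_card:
  assumes "finite X"
  shows "minor_sum A (card X) X = pdet A X"
proof -
  have "{Y. Y \<subseteq> X \<and> card Y = card X} = {X}" using assms card_subset_eq by auto
  then show ?thesis by (simp add: minor_sum_def)
qed

lemma degree_pchar_poly [simp]:
  assumes "finite X"
  shows "degree (pchar_poly A X) = card X"
proof (rule antisym)
  show "degree (pchar_poly A X) \<le> card X"
    unfolding pchar_poly_def using assms
    by (intro degree_sum_le) (auto intro: order.trans[OF degree_monom_le])
  have "{Y. Y \<subseteq> X \<and> card Y = 0} = {{}}"
    using assms by (auto dest: finite_subset)
  then have "minor_sum A 0 X = 1" by (simp add: minor_sum_def)
  then show "card X \<le> degree (pchar_poly A X)"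
    using coeff_pchar_poly[OF assms, of 0 A] by (intro le_degree) simp
qed

lemma signed_coeff_pchar_poly:
  assumes "finite X"
  shows "signed_coeff r (pchar_poly A X) = minor_sum A r X"
proof (cases "r \<le> card X")
  case True
  then show ?thesis
    using assms coeff_pchar_poly[OF assms True, of A]
    by (simp add: signed_coeff_def mult.assoc[symmetric] power_mult_distrib[symmetric])
next
  case False
  then have empty: "{Y. Y \<subseteq> X \<and> card Y = r} = {}" using assms card_mono by blast
  show ?thesis using False assms unfolding minor_sum_def empty by (simp add: signed_coeff_def)
qed

text \<open>The form in which the deck is used: it determines any sum over the proper subsets whose
  terms depend only on the characteristic polynomials.\<close>

lemma same_deck_sum:
  assumes "same_deck A B V"
  shows "(\<Sum>X | X \<subset> V. f (pchar_poly A X)) = (\<Sum>X | X \<subset> V. f (pchar_poly B X))"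
proof -
  have "sum_mset (image_mset f (image_mset (pchar_poly A) (mset_set {X. X \<subset> V})))
      = sum_mset (image_mset f (image_mset (pchar_poly B) (mset_set {X. X \<subset> V})))"
    using assms by (simp only: same_deck_def)
  then show ?thesis by (simp add: sum_unfold_sum_mset image_mset.compositionality o_def)
qed

lemma finite_psubsets: "finite V \<Longrightarrow> finite {X. X \<subset> V}"
  by (rule finite_subset[of _ "Pow V"]) auto

text \<open>A set of size \<open>r < card V\<close> is itself a card, and its minor is, up to sign,
  the constant term of its polynomial. Summing over the cards of degree \<open>r\<close> gives the
  minor sum of all of \<open>V\<close>.\<close>

lemma same_deck_minor_sum:
  assumes "same_deck A B V" and V: "finite V" and r: "r < card V"
  shows "minor_sum A r V = minor_sum B r V"
proof -
  have *: "minor_sum A r V = (\<Sum>X | X \<subset> V.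
      (\<lambda>p. if degree p = r then signed_coeff r p else 0) (pchar_poly A X))"
    for A :: "'a \<Rightarrow> 'a \<Rightarrow> 'b"
    unfolding minor_sum_def
  proof (rule sum.mono_neutral_cong_left)
    fix X assume X: "X \<in> {Y. Y \<subseteq> V \<and> card Y = r}"
    then have "finite X" using V finite_subset by auto
    then show "pdet A X = (if degree (pchar_poly A X) = r then signed_coeff r (pchar_poly A X) else 0)"
      using X minor_sum_card[of X A] by (auto simp: signed_coeff_pchar_poly)
  next
    show "\<forall>X\<in>{X. X \<subset> V} - {Y. Y \<subseteq> V \<and> card Y = r}.
        (if degree (pchar_poly A X) = r then signed_coeff r (pchar_poly A X) else 0) = 0"
      using V by (auto dest: finite_subset[rotated])
  qed (use V r finite_psubsets in auto)
  show ?thesis using same_deck_sum[OF assms(1)] by (simp only: *)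
qed

text \<open>Passing to complements turns the sum into the expansion of a product of factors
  \<open>-1 + 1\<close> over \<open>V - U\<close>, which vanishes unless the product is
  empty.\<close>

lemma alternating_sum_supersets:
  assumes V: "finite V" and "U \<subseteq> V"
  shows "(\<Sum>X | U \<subseteq> X \<and> X \<subseteq> V. (-1) ^ card (V - X)) = (if U = V then 1 else 0 :: 'b::comm_ring_1)"
proof -
  have "(\<Sum>X | U \<subseteq> X \<and> X \<subseteq> V. (-1) ^ card (V - X)) = (\<Sum>W\<in>Pow (V - U). (-1) ^ card W :: 'b)"
    by (rule sum.reindex_bij_witness[where i = "\<lambda>W. V - W" and j = "\<lambda>X. V - X"])
      (use assms in auto)
  also have "\<dots> = (\<Prod>x\<in>V - U. -1 + 1)"
    using V by (subst prod_add) auto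
  also have "\<dots> = (if U = V then 1 else 0)"
    using assms by (auto simp: power_0_left)
  finally show ?thesis .
qed

section \<open>Coverings\<close>

text \<open>Indexed families with overlaps allowed, since these are what a product of minor sums
  expands into. \<open>PiE\<close> fixes the values outside \<open>J\<close>, so that each family is
  counted once.\<close>

definition covers :: "'i set \<Rightarrow> ('i \<Rightarrow> nat) \<Rightarrow> 'a set \<Rightarrow> ('i \<Rightarrow> 'a set) set" where
  "covers J l V = {Y \<in> PiE J (\<lambda>j. {S. S \<subseteq> V \<and> card S = l j}). (\<Union>j\<in>J. Y j) = V}"

lemma finite_covers:
  assumes "finite V" "finite J"
  shows "finite (covers J l V)"
  unfolding covers_def using assms 
  by (intro finite_subset[OF _ finite_PiE[of J "\<lambda>_. Pow V"]]) (simp_all add: PiE_iff subset_iff)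

text \<open>The analogue of Kocay's lemma in the theory of graph reconstruction.\<close>

lemma sum_covers:
  fixes A :: "'a \<Rightarrow> 'a \<Rightarrow> 'b::comm_ring_1"
  assumes V: "finite V" and J: "finite J"
  shows "(\<Sum>Y\<in>covers J l V. \<Prod>j\<in>J. pdet A (Y j))
    = (\<Sum>X\<in>Pow V. (-1) ^ card (V - X) * (\<Prod>j\<in>J. minor_sum A (l j) X))"
proof -
  let ?P = "\<lambda>X. PiE J (\<lambda>j. {S. S \<subseteq> X \<and> card S = l j})"
  let ?g = "\<lambda>Y. \<Prod>j\<in>J. pdet A (Y j)"
  have fin: "finite (?P V)" using V J by (intro finite_PiE) auto
  have "(\<Sum>X\<in>Pow V. (-1) ^ card (V - X) * (\<Prod>j\<in>J. minor_sum A (l j) X))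
      = (\<Sum>X\<in>Pow V. \<Sum>Y\<in>?P V. if (\<Union>j\<in>J. Y j) \<subseteq> X then (-1) ^ card (V - X) * ?g Y else 0)"
  proof (rule sum.cong[OF refl])
    fix X assume "X \<in> Pow V"
    then have X: "X \<subseteq> V" "finite X" using V finite_subset by auto
    have eq: "{Y \<in> ?P V. (\<Union>j\<in>J. Y j) \<subseteq> X} = ?P X"
      by (rule Set.set_eqI) (simp add: PiE_iff UN_subset_iff, meson X(1) subset_trans)
    have "(\<Prod>j\<in>J. minor_sum A (l j) X) = (\<Sum>Y\<in>?P X. ?g Y)"
      unfolding minor_sum_def using X by (intro prod_sum_PiE J) auto
    then show "(-1) ^ card (V - X) * (\<Prod>j\<in>J. minor_sum A (l j) X)
      = (\<Sum>Y\<in>?P V. if (\<Union>j\<in>J. Y j) \<subseteq> X then (-1) ^ card (V - X) * ?g Y else 0)"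
      using fin by (simp add: sum_distrib_left flip: sum.inter_filter eq)
  qed
  also have "\<dots> = (\<Sum>Y\<in>?P V. \<Sum>X\<in>Pow V. if (\<Union>j\<in>J. Y j) \<subseteq> X then (-1) ^ card (V - X) * ?g Y else 0)"
    by (rule sum.swap)
  \<comment> \<open>The alternating sum over the sets \<open>X\<close> that contain the union
    cancels unless the union is \<open>V\<close>.\<close>
  also have "\<dots> = (\<Sum>Y\<in>?P V. if (\<Union>j\<in>J. Y j) = V then ?g Y else 0)"
  proof (rule sum.cong[OF refl])
    fix Y assume "Y \<in> ?P V"
    then have Y: "(\<Union>j\<in>J. Y j) \<subseteq> V" by (auto simp: PiE_iff)
    have "(\<Sum>X\<in>Pow V. if (\<Union>j\<in>J. Y j) \<subseteq> X then (-1) ^ card (V - X) * ?g Y else 0)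
      = (\<Sum>X | (\<Union>j\<in>J. Y j) \<subseteq> X \<and> X \<subseteq> V. (-1) ^ card (V - X)) * ?g Y"
      unfolding sum_distrib_right
      by (rule sum.mono_neutral_cong_right) (use V in auto)
    then show "(\<Sum>X\<in>Pow V. if (\<Union>j\<in>J. Y j) \<subseteq> X then (-1) ^ card (V - X) * ?g Y else 0)
      = (if (\<Union>j\<in>J. Y j) = V then ?g Y else 0)"
      by (simp add: alternating_sum_supersets[OF V Y])
  qed
  also have "\<dots> = (\<Sum>Y\<in>covers J l V. ?g Y)"
    unfolding covers_def by (rule sum.inter_filter[OF fin, symmetric])
  finally show ?thesis by simp
qed

text \<open>In the alternating formula of \<open>sum_covers\<close> only the term
  \<open>X = V\<close> is not a card. Its factors are minor sums of sizes below
  \<open>card V\<close>, hence known; in the other terms the sign depends on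
  \<open>card (V - X)\<close>, which the degree of the card reveals.\<close>

lemma same_deck_covers:
  assumes deck: "same_deck A B V" and V: "finite V" and J: "finite J"
    and l: "\<And>j. j \<in> J \<Longrightarrow> l j < card V"
  shows "(\<Sum>Y\<in>covers J l V. \<Prod>j\<in>J. pdet A (Y j)) = (\<Sum>Y\<in>covers J l V. \<Prod>j\<in>J. pdet B (Y j))"
proof -
  have Pow: "Pow V = insert V {X. X \<subset> V}" by auto
  have *: "(\<Sum>Y\<in>covers J l V. \<Prod>j\<in>J. pdet A (Y j))
    = (\<Prod>j\<in>J. minor_sum A (l j) V) + (\<Sum>X | X \<subset> V.
       (\<lambda>p. (-1) ^ (card V - degree p) * (\<Prod>j\<in>J. signed_coeff (l j) p)) (pchar_poly A X))"
    for A :: "'a \<Rightarrow> 'a \<Rightarrow> 'b"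
  proof -
    have "(\<Sum>X | X \<subset> V. (-1) ^ card (V - X) * (\<Prod>j\<in>J. minor_sum A (l j) X))
      = (\<Sum>X | X \<subset> V.
       (\<lambda>p. (-1) ^ (card V - degree p) * (\<Prod>j\<in>J. signed_coeff (l j) p)) (pchar_poly A X))"
    proof (rule sum.cong[OF refl])
      fix X assume "X \<in> {X. X \<subset> V}"
      then have X: "X \<subseteq> V" "finite X" using V finite_subset by auto
      then show "(-1) ^ card (V - X) * (\<Prod>j\<in>J. minor_sum A (l j) X)
        = (\<lambda>p. (-1) ^ (card V - degree p) * (\<Prod>j\<in>J. signed_coeff (l j) p)) (pchar_poly A X)"
        by (simp add: signed_coeff_pchar_poly card_Diff_subset)
    qed
    then show ?thesis
      unfolding sum_covers[OF V J] Pow using finite_psubsets[OF V] by simp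
  qed
  have "(\<Prod>j\<in>J. minor_sum A (l j) V) = (\<Prod>j\<in>J. minor_sum B (l j) V)"
    by (intro prod.cong refl same_deck_minor_sum deck V l)
  moreover note same_deck_sum[OF deck, of
      "\<lambda>p. (-1) ^ (card V - degree p) * (\<Prod>j\<in>J. signed_coeff (l j) p)"]
  ultimately show ?thesis by (simp only: *)
qed

text \<open>A permutation that stabilizes two disjoint sets is composed of permutations of the two,
  and signs multiply. The predicate \<open>Q\<close> depends only on the values on \<open>Y\<close>;
  it carries the stability of the remaining blocks through the induction in
  \<open>prod_pdet\<close>.\<close>

lemma pdet_Un_stable:
  assumes "finite X" "finite Y" "X \<inter> Y = {}"
    and stab: "\<And>p r. (\<forall>y\<in>Y. p y = r y) \<Longrightarrow> Q p \<longleftrightarrow> Q r"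
  shows "pdet A X * (\<Sum>q | q permutes Y \<and> Q q. of_int (sign q) * (\<Prod>y\<in>Y. A y (q y)))
    = (\<Sum>p | p permutes (X \<union> Y) \<and> p ` X = X \<and> p ` Y = Y \<and> Q p.
         of_int (sign p) * (\<Prod>x\<in>X \<union> Y. A x (p x)))"
proof -
  have perm: "permutation p" if "p permutes X \<or> p permutes Y" for p
    using that assms(1,2) by (auto simp: permutation_permutes)
  have "pdet A X * (\<Sum>q | q permutes Y \<and> Q q. of_int (sign q) * (\<Prod>y\<in>Y. A y (q y)))
    = (\<Sum>(p, q)\<in>{p. p permutes X} \<times> {q. q permutes Y \<and> Q q}.
        of_int (sign p * sign q) * ((\<Prod>x\<in>X. A x (p x)) * (\<Prod>y\<in>Y. A y (q y))))"
    unfolding pdet_def sum_product sum.cartesian_product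
    by (rule sum.cong) (auto simp: mult_ac)
  also have "\<dots> = (\<Sum>p | p permutes (X \<union> Y) \<and> p ` X = X \<and> p ` Y = Y \<and> Q p.
         of_int (sign p) * (\<Prod>x\<in>X \<union> Y. A x (p x)))"
  proof (rule sum.reindex_bij_witness[where j = "\<lambda>(p, q). p \<circ> q"
        and i = "\<lambda>r. (restrict_id r X, restrict_id r Y)"])
    fix a assume "a \<in> {p. p permutes X} \<times> {q. q permutes Y \<and> Q q}"
    then obtain p q where a: "a = (p, q)" and p: "p permutes X" and q: "q permutes Y" and "Q q"
      by auto
    have X: "(p \<circ> q) x = p x" if "x \<in> X" for x
      using that assms(3) permutes_not_in[OF q] by fastforce
    have Y: "(p \<circ> q) y = q y" if "y \<in> Y" for y
    proof -
      have "q y \<notin> X" using that assms(3) permutes_in_image[OF q] by auto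
      then show ?thesis by (simp add: permutes_not_in[OF p])
    qed
    have "restrict_id (p \<circ> q) X = p"
      using X by (auto simp: restrict_id_def fun_eq_iff permutes_not_in[OF p])
    moreover have "restrict_id (p \<circ> q) Y = q"
      using Y by (auto simp: restrict_id_def fun_eq_iff permutes_not_in[OF q])
    ultimately show "(\<lambda>r. (restrict_id r X, restrict_id r Y)) ((\<lambda>(p, q). p \<circ> q) a) = a"
      by (simp add: a)
    have "(p \<circ> q) ` X = X" using X permutes_image[OF p] by (metis image_cong)
    moreover have "(p \<circ> q) ` Y = Y" using Y permutes_image[OF q] by (metis image_cong)
    moreover have "p \<circ> q permutes (X \<union> Y)"
      using p q by (intro permutes_compose) (auto intro: permutes_subset)
    moreover have "Q (p \<circ> q)" using stab[of "p \<circ> q" q] Y \<open>Q q\<close> by blast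
    ultimately show "(\<lambda>(p, q). p \<circ> q) a \<in> {p. p permutes (X \<union> Y) \<and> p ` X = X \<and> p ` Y = Y \<and> Q p}"
      by (simp add: a)
    have "(\<Prod>x\<in>X \<union> Y. A x ((p \<circ> q) x)) = (\<Prod>x\<in>X. A x (p x)) * (\<Prod>y\<in>Y. A y (q y))"
      using assms X Y by (simp only: prod.union_disjoint) (simp cong: prod.cong)
    then show "of_int (sign ((\<lambda>(p, q). p \<circ> q) a)) * (\<Prod>x\<in>X \<union> Y. A x ((\<lambda>(p, q). p \<circ> q) a x))
      = (case a of (p, q) \<Rightarrow>
          of_int (sign p * sign q) * ((\<Prod>x\<in>X. A x (p x)) * (\<Prod>y\<in>Y. A y (q y))))"
      using p q by (simp add: a sign_compose perm)
  next
    fix r assume r: "r \<in> {p. p permutes (X \<union> Y) \<and> p ` X = X \<and> p ` Y = Y \<and> Q p}"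
    then have "inj r" by (auto intro: permutes_inj)
    then have "bij_betw r X X" "bij_betw r Y Y"
      using r by (auto simp: bij_betw_def intro: inj_on_subset)
    then have "restrict_id r X permutes X" "restrict_id r Y permutes Y"
      by (auto intro: permutes_restrict_id)
    moreover have "Q (restrict_id r Y)" using stab[of "restrict_id r Y" r] r by auto
    ultimately show "(restrict_id r X, restrict_id r Y) \<in> {p. p permutes X} \<times> {q. q permutes Y \<and> Q q}"
      by simp
    show "(\<lambda>(p, q). p \<circ> q) (restrict_id r X, restrict_id r Y) = r"
    proof
      fix x
      consider "x \<in> X" | "x \<in> Y" | "x \<notin> X \<union> Y" by blast
      then show "(\<lambda>(p, q). p \<circ> q) (restrict_id r X, restrict_id r Y) x = r x"
      proof cases
        case 1
        then show ?thesis using assms(3) by (auto simp: restrict_id_def)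
      next
        case 2
        then have "r x \<notin> X" using r assms(3) by blast
        then show ?thesis using 2 by (simp add: restrict_id_def)
      next
        case 3
        then have "r x = x" using r by (auto intro: permutes_not_in)
        then show ?thesis using 3 by (simp add: restrict_id_def)
      qed
    qed
  qed
  finally show ?thesis .
qed

text \<open>Combining one permutation of each block gives exactly the permutations of the union that
  preserve every block; the blocks are split off one at a time.\<close>

lemma prod_pdet:
  assumes "finite J" and "\<And>j. j \<in> J \<Longrightarrow> finite (Y j)" and "disjoint_family_on Y J"
  shows "(\<Prod>j\<in>J. pdet A (Y j)) = (\<Sum>p | p permutes (\<Union>j\<in>J. Y j) \<and> (\<forall>j\<in>J. p ` Y j = Y j).
      of_int (sign p) * (\<Prod>x\<in>(\<Union>j\<in>J. Y j). A x (p x)))"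
  using assms
proof (induction J rule: finite_induct)
  case empty
  then show ?case by simp
next
  case (insert j J)
  let ?U = "\<Union>i\<in>J. Y i"
  have disj: "Y j \<inter> ?U = {}"
    using insert.prems(2) insert.hyps(2) by (auto simp: disjoint_family_on_def)
  have stab_Un: "p ` ?U = ?U" if "\<forall>j\<in>J. p ` Y j = Y j" for p
    using that by (simp add: image_UN)
  have "(\<Prod>j\<in>insert j J. pdet A (Y j)) = pdet A (Y j) *
      (\<Sum>p | p permutes ?U \<and> (\<forall>j\<in>J. p ` Y j = Y j). of_int (sign p) * (\<Prod>x\<in>?U. A x (p x)))"
    using insert by (simp add: disjoint_family_on_def)
  also have "\<dots> = (\<Sum>p | p permutes (Y j \<union> ?U) \<and> p ` Y j = Y j \<and> p ` ?U = ?U \<and> (\<forall>j\<in>J. p ` Y j = Y j).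
      of_int (sign p) * (\<Prod>x\<in>Y j \<union> ?U. A x (p x)))"
  proof (rule pdet_Un_stable)
    show "finite (Y j)" "finite ?U" using insert by auto
    show "Y j \<inter> ?U = {}" by (rule disj)
    fix p r :: "'b \<Rightarrow> 'b" assume "\<forall>y\<in>?U. p y = r y"
    then have "p ` Y j = r ` Y j" if "j \<in> J" for j using that by (intro image_cong) auto
    then show "(\<forall>j\<in>J. p ` Y j = Y j) \<longleftrightarrow> (\<forall>j\<in>J. r ` Y j = Y j)" by simp
  qed
  also have "{p. p permutes (Y j \<union> ?U) \<and> p ` Y j = Y j \<and> p ` ?U = ?U \<and> (\<forall>j\<in>J. p ` Y j = Y j)}
      = {p. p permutes (\<Union>j\<in>insert j J. Y j) \<and> (\<forall>j\<in>insert j J. p ` Y j = Y j)}"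
    unfolding UN_insert ball_simps using stab_Un by blast
  finally show ?case by simp
qed

text \<open>A union has at most as many elements as the sizes add up to, and equality leaves no room
  for an intersection at any insertion.\<close>

lemma disjoint_family_on_of_card:
  assumes "finite J" and "\<And>j. j \<in> J \<Longrightarrow> finite (Y j)"
    and "card (\<Union>j\<in>J. Y j) = (\<Sum>j\<in>J. card (Y j))"
  shows "disjoint_family_on Y J"
  using assms
proof (induction J rule: finite_induct)
  case empty
  then show ?case by (simp add: disjoint_family_on_def)
next
  case (insert j J)
  let ?U = "\<Union>i\<in>J. Y i"
  have fin: "finite (Y j)" "finite ?U" using insert by auto
  have 1: "card ?U \<le> (\<Sum>j\<in>J. card (Y j))" using insert.hyps(1) by (rule card_UN_le)
  have 2: "card (Y j \<union> ?U) + card (Y j \<inter> ?U) = card (Y j) + card ?U"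
    using card_Un_Int[OF fin] by simp
  have 3: "card (Y j \<union> ?U) = card (Y j) + (\<Sum>j\<in>J. card (Y j))"
    using insert by simp
  have "card (Y j \<inter> ?U) = 0" "card ?U = (\<Sum>j\<in>J. card (Y j))" using 1 2 3 by linarith+
  then have "Y j \<inter> ?U = {}" "disjoint_family_on Y J" using fin insert by auto
  then show ?case using insert.hyps(2) by (auto simp: disjoint_family_on_insert)
qed

section \<open>Sums over conjugacy classes\<close>

definition perm_weight :: "('a \<Rightarrow> 'a \<Rightarrow> 'b::comm_ring_1) \<Rightarrow> 'a set \<Rightarrow> ('a \<Rightarrow> 'a) \<Rightarrow> 'b" where
  "perm_weight A V p = (\<Prod>x\<in>V. A x (p x))"

text \<open>
  Each conjugate of \<open>p\<close> occurs here as often as \<open>p\<close> has centralizing permutations, which avoids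
  choosing representatives of the conjugacy classes.
\<close>

definition conj_sum :: "('a \<Rightarrow> 'a \<Rightarrow> 'b::comm_ring_1) \<Rightarrow> 'a set \<Rightarrow> ('a \<Rightarrow> 'a) \<Rightarrow> 'b" where
  "conj_sum A V p = (\<Sum>t | t permutes V. perm_weight A V (t \<circ> p \<circ> inv_into UNIV t))"

text \<open>For a permutation of a finite \<open>V\<close> the fixed points form orbits of size 1,
  so that the orbits partition \<open>V\<close>.\<close>

definition orbits :: "'a set \<Rightarrow> ('a \<Rightarrow> 'a) \<Rightarrow> 'a set set" where
  "orbits V p = orbit p ` V"

text \<open>With a 0-1 matrix each summand of \<open>conj_sum\<close> thus tells whether the
  relabelling \<open>t\<close> sends every pair \<open>(x, p x)\<close> to an edge.\<close>

lemma perm_weight_conj: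
  assumes "t permutes V"
  shows "perm_weight A V (t \<circ> p \<circ> inv_into UNIV t) = (\<Prod>x\<in>V. A (t x) (t (p x)))"
proof -
  have "bij_betw t V V" using assms by (rule permutes_imp_bij)
  then have "perm_weight A V (t \<circ> p \<circ> inv_into UNIV t) = (\<Prod>x\<in>V. A (t x) ((t \<circ> p \<circ> inv_into UNIV t) (t x)))"
    unfolding perm_weight_def by (rule prod.reindex_bij_betw[symmetric])
  then show ?thesis by (simp add: permutes_inverses[OF assms])
qed

lemma sum_permutes_conj:
  assumes t: "t permutes V"
  shows "(\<Sum>p | p permutes V. f (t \<circ> p \<circ> inv_into UNIV t)) = (\<Sum>p | p permutes V. f p)"
proof (rule sum.reindex_bij_witness[where j = "\<lambda>p. t \<circ> p \<circ> inv_into UNIV t" and i = "\<lambda>p. inv_into UNIV t \<circ> p \<circ> t"])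
  fix p assume "p \<in> {p. p permutes V}"
  then show "inv_into UNIV t \<circ> p \<circ> t \<in> {p. p permutes V}" "t \<circ> p \<circ> inv_into UNIV t \<in> {p. p permutes V}"
    using t by (auto intro!: permutes_compose permutes_inv)
qed (simp_all add: fun_eq_iff permutes_inverses[OF t])

lemma conj_sum_conj:
  assumes s: "s permutes V"
  shows "conj_sum A V (s \<circ> p \<circ> inv_into UNIV s) = conj_sum A V p"
  unfolding conj_sum_def
proof (rule sum.reindex_bij_witness[where j = "\<lambda>t. t \<circ> s" and i = "\<lambda>t. t \<circ> inv_into UNIV s"])
  fix t assume "t \<in> {t. t permutes V}"
  then have t: "t permutes V" by simp
  have "inv_into UNIV (t \<circ> s) = inv_into UNIV s \<circ> inv_into UNIV t"
    using s t by (intro o_inv_distrib) (auto intro: permutes_bij)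
  then show "perm_weight A V (t \<circ> s \<circ> p \<circ> inv_into UNIV (t \<circ> s))
      = perm_weight A V (t \<circ> (s \<circ> p \<circ> inv_into UNIV s) \<circ> inv_into UNIV t)" by (simp add: o_assoc)
qed (use s in \<open>auto simp: fun_eq_iff permutes_inverses intro!: permutes_compose permutes_inv\<close>)

text \<open>Interchange the sums. For fixed \<open>t\<close>, conjugation permutes the permutations
  of \<open>V\<close> and leaves \<open>f\<close> unchanged, so each of the
  \<open>fact (card V)\<close> choices of \<open>t\<close> contributes the same amount.\<close>

lemma sum_class_function:
  fixes A :: "'a \<Rightarrow> 'a \<Rightarrow> 'b::comm_ring_1"
  assumes V: "finite V"
    and f: "\<And>t p. t permutes V \<Longrightarrow> p permutes V \<Longrightarrow> f (t \<circ> p \<circ> inv_into UNIV t) = f p"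
  shows "(\<Sum>p | p permutes V. f p * conj_sum A V p)
    = of_nat (fact (card V)) * (\<Sum>p | p permutes V. f p * perm_weight A V p)"
proof -
  have "(\<Sum>p | p permutes V. f p * conj_sum A V p)
      = (\<Sum>t | t permutes V. \<Sum>p | p permutes V. f p * perm_weight A V (t \<circ> p \<circ> inv_into UNIV t))"
    unfolding conj_sum_def sum_distrib_left by (rule sum.swap)
  also have "\<dots> = (\<Sum>t | t permutes V. \<Sum>p | p permutes V. f p * perm_weight A V p)"
  proof (rule sum.cong[OF refl])
    fix t assume "t \<in> {t. t permutes V}"
    then have t: "t permutes V" by simp
    have "(\<Sum>p | p permutes V. f p * perm_weight A V (t \<circ> p \<circ> inv_into UNIV t))
      = (\<Sum>p | p permutes V. (\<lambda>q. f q * perm_weight A V q) (t \<circ> p \<circ> inv_into UNIV t))"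
      using f[OF t] by (intro sum.cong) auto
    also have "\<dots> = (\<Sum>p | p permutes V. f p * perm_weight A V p)"
      by (rule sum_permutes_conj[OF t])
    finally show "(\<Sum>p | p permutes V. f p * perm_weight A V (t \<circ> p \<circ> inv_into UNIV t))
      = (\<Sum>p | p permutes V. f p * perm_weight A V p)" .
  qed
  also have "\<dots> = of_nat (fact (card V)) * (\<Sum>p | p permutes V. f p * perm_weight A V p)"
    using card_permutations[OF refl V] by simp
  finally show ?thesis .
qed

lemma sign_conj:
  assumes "finite V" "t permutes V" "p permutes V"
  shows "sign (t \<circ> p \<circ> inv_into UNIV t) = sign p"
proof -
  have "permutation t" "permutation p" using assms by (auto simp: permutation_permutes)
  then show ?thesis
    by (simp add: sign_compose permutation_compose permutation_inverse sign_inverse)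
qed

text \<open>The sign is a class function, so the full determinant is known up to a factorial once
  all conjugacy sums are.\<close>

lemma sum_sign_conj_sum:
  assumes "finite V"
  shows "(\<Sum>p | p permutes V. of_int (sign p) * conj_sum A V p) = of_nat (fact (card V)) * pdet A V"
  using sum_class_function[OF assms, of "\<lambda>p. of_int (sign p)" A] sign_conj[OF assms]
  by (simp add: pdet_def perm_weight_def)

section \<open>Coverings stabilized by a permutation\<close>

definition stable_covers ::
    "'i set \<Rightarrow> ('i \<Rightarrow> nat) \<Rightarrow> 'a set \<Rightarrow> ('a \<Rightarrow> 'a) \<Rightarrow> ('i \<Rightarrow> 'a set) set" where
  "stable_covers J l V p = {Y \<in> covers J l V. \<forall>j\<in>J. p ` Y j = Y j}"

lemma finite_stable_covers:
  "finite V \<Longrightarrow> finite J \<Longrightarrow> finite (stable_covers J l V p)"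
  by (simp add: stable_covers_def finite_covers)

text \<open>Taking images under \<open>s\<close> maps the coverings stable for \<open>q\<close>
  injectively to those stable for its conjugate. Applying this to \<open>t\<close> and to its
  inverse gives both inequalities.\<close>

lemma card_stable_covers_conj:
  assumes V: "finite V" and J: "finite J" and t: "t permutes V"
  shows "card (stable_covers J l V (t \<circ> p \<circ> inv_into UNIV t)) = card (stable_covers J l V p)"
proof -
  have *: "(\<lambda>Y. \<lambda>j\<in>J. s ` Y j) \<in> stable_covers J l V q \<rightarrow> stable_covers J l V (s \<circ> q \<circ> inv_into UNIV s)"
    if s: "s permutes V" for s q
  proof
    fix Y assume Y: "Y \<in> stable_covers J l V q"
    have inj: "inj_on s X" for X using s by (meson permutes_inj inj_on_subset subset_UNIV)
    have im: "s ` V = V" using s by (rule permutes_image)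
    have 1: "s ` Y j \<subseteq> V" "card (s ` Y j) = l j" if "j \<in> J" for j
      using Y that im card_image[OF inj] by (auto simp: stable_covers_def covers_def PiE_iff)
    have 2: "(\<Union>j\<in>J. s ` Y j) = V"
      using Y im by (simp add: stable_covers_def covers_def flip: image_UN)
    have 3: "(s \<circ> q \<circ> inv_into UNIV s) ` s ` Y j = s ` Y j" if "j \<in> J" for j
    proof -
      have "(s \<circ> q \<circ> inv_into UNIV s) ` s ` Y j = s ` q ` Y j"
        by (simp add: image_image permutes_inverses[OF s])
      then show ?thesis using Y that by (simp add: stable_covers_def)
    qed
    show "(\<lambda>j\<in>J. s ` Y j) \<in> stable_covers J l V (s \<circ> q \<circ> inv_into UNIV s)"
      using 1 2 3 by (simp add: stable_covers_def covers_def PiE_iff)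
  qed
  have inj: "inj_on (\<lambda>Y. \<lambda>j\<in>J. s ` Y j) (stable_covers J l V q)" if s: "s permutes V" for s q
  proof (rule inj_onI)
    fix Y Z assume Y: "Y \<in> stable_covers J l V q" and Z: "Z \<in> stable_covers J l V q"
      and eq: "(\<lambda>j\<in>J. s ` Y j) = (\<lambda>j\<in>J. s ` Z j)"
    have "Y j = Z j" if "j \<in> J" for j
      using fun_cong[OF eq, of j] that inj_image_eq_iff[OF permutes_inj[OF s]] by simp
    moreover have "Y \<in> extensional J" "Z \<in> extensional J"
      using Y Z by (simp_all add: stable_covers_def covers_def PiE_iff)
    ultimately show "Y = Z" by (intro extensionalityI)
  qed
  have le: "card (stable_covers J l V q) \<le> card (stable_covers J l V (s \<circ> q \<circ> inv_into UNIV s))"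
    if "s permutes V" for s q
    using card_inj_on_le[OF inj[OF that] _ finite_stable_covers[OF V J]] *[OF that] by blast
  have "inv_into UNIV t \<circ> (t \<circ> p \<circ> inv_into UNIV t) \<circ> inv_into UNIV (inv_into UNIV t) = p"
    using t by (simp add: fun_eq_iff permutes_inverses permutes_inv_inv)
  then show ?thesis
    using le[OF t, of p] le[OF permutes_inv[OF t], of "t \<circ> p \<circ> inv_into UNIV t"] by simp
qed

lemma disjoint_covers:
  assumes "finite V" "finite J" "(\<Sum>j\<in>J. l j) = card V" "Y \<in> covers J l V"
  shows "disjoint_family_on Y J"
  using assms
  by (intro disjoint_family_on_of_card) (auto simp: covers_def PiE_iff intro: finite_subset)

text \<open>When the sizes add up to \<open>card V\<close>, every covering is a partition, and its
  product of minors is a sum over the permutations stabilizing all its blocks. Interchanging the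
  sums counts each permutation once for every covering that it stabilizes.\<close>

lemma sum_covers_eq_sum_permutes:
  fixes A :: "'a \<Rightarrow> 'a \<Rightarrow> 'b::comm_ring_1"
  assumes V: "finite V" and J: "finite J" and l: "(\<Sum>j\<in>J. l j) = card V"
  shows "(\<Sum>Y\<in>covers J l V. \<Prod>j\<in>J. pdet A (Y j))
    = (\<Sum>p | p permutes V. of_int (sign p * int (card (stable_covers J l V p))) * perm_weight A V p)"
proof -
  let ?w = "\<lambda>p. of_int (sign p) * perm_weight A V p"
  have fin: "finite {p. p permutes V}" using V by (rule finite_permutations)
  have "(\<Sum>Y\<in>covers J l V. \<Prod>j\<in>J. pdet A (Y j))
    = (\<Sum>Y\<in>covers J l V. \<Sum>p | p permutes V. if \<forall>j\<in>J. p ` Y j = Y j then ?w p else 0)"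
  proof (rule sum.cong[OF refl])
    fix Y assume Y: "Y \<in> covers J l V"
    then have U: "(\<Union>j\<in>J. Y j) = V" by (simp add: covers_def)
    have "(\<Prod>j\<in>J. pdet A (Y j)) = (\<Sum>p | p permutes V \<and> (\<forall>j\<in>J. p ` Y j = Y j). ?w p)"
      using prod_pdet[OF J _ disjoint_covers[OF V J l Y], of A] U V
      by (auto simp: perm_weight_def intro: finite_subset)
    also have "\<dots> = (\<Sum>p | p permutes V. if \<forall>j\<in>J. p ` Y j = Y j then ?w p else 0)"
      using sum.inter_filter[OF fin, of ?w "\<lambda>p. \<forall>j\<in>J. p ` Y j = Y j"] by simp
    finally show "(\<Prod>j\<in>J. pdet A (Y j))
      = (\<Sum>p | p permutes V. if \<forall>j\<in>J. p ` Y j = Y j then ?w p else 0)" .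
  qed
  also have "\<dots> = (\<Sum>p | p permutes V. \<Sum>Y\<in>covers J l V. if \<forall>j\<in>J. p ` Y j = Y j then ?w p else 0)"
    by (rule sum.swap)
  also have "\<dots> = (\<Sum>p | p permutes V.
      of_int (sign p * int (card (stable_covers J l V p))) * perm_weight A V p)"
  proof (rule sum.cong[OF refl])
    fix p assume "p \<in> {p. p permutes V}"
    have "(\<Sum>Y\<in>covers J l V. if \<forall>j\<in>J. p ` Y j = Y j then ?w p else 0)
      = (\<Sum>Y\<in>stable_covers J l V p. ?w p)"
      unfolding stable_covers_def by (rule sum.inter_filter[OF finite_covers[OF V J], symmetric])
    then show "(\<Sum>Y\<in>covers J l V. if \<forall>j\<in>J. p ` Y j = Y j then ?w p else 0)
      = of_int (sign p * int (card (stable_covers J l V p))) * perm_weight A V p"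
      by (simp add: mult_ac)
  qed
  finally show ?thesis .
qed

section \<open>Orbits and conjugation of permutations\<close>

lemma orbit_subset_stable:
  assumes "p ` S \<subseteq> S" "x \<in> S"
  shows "orbit p x \<subseteq> S"
proof
  fix y assume "y \<in> orbit p x"
  then show "y \<in> S" by induction (use assms in auto)
qed

lemma cyclic_on_enum:
  assumes "cyclic_on f S"
  obtains s where "bij_betw (\<lambda>n. (f ^^ n) s) {..<card S} S" and "(f ^^ card S) s = s"
proof -
  obtain s where s: "s \<in> S" "S = orbit f s" using assms by (auto simp: cyclic_on_def)
  then have self: "s \<in> orbit f s" by simp
  let ?k = "funpow_dist1 f s s"
  have bij: "bij_betw (\<lambda>n. (f ^^ n) s) {..<?k} S"
    using inj_on_funpow_dist1[OF self] orbit_conv_funpow_dist1[OF self] s(2)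
    by (simp add: bij_betw_def atLeast0LessThan)
  then have "card S = ?k" using bij_betw_same_card by fastforce
  then show ?thesis using that[of s] bij funpow_dist1_prop[OF self] by simp
qed

text \<open>Two cycles of the same length are matched by sending the \<open>n\<close>-th iterate of
  one base point to the \<open>n\<close>-th iterate of the other.\<close>

lemma cyclic_on_bij:
  assumes "cyclic_on f S" "cyclic_on g T" "card S = card T"
  obtains h where "bij_betw h S T" and "\<And>x. x \<in> S \<Longrightarrow> h (f x) = g (h x)"
proof -
  let ?k = "card S"
  obtain s where s: "bij_betw (\<lambda>n. (f ^^ n) s) {..<?k} S" "(f ^^ ?k) s = s"
    using assms(1) by (rule cyclic_on_enum)
  obtain t where t: "bij_betw (\<lambda>n. (g ^^ n) t) {..<?k} T" "(g ^^ ?k) t = t"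
    using assms(2) by (rule cyclic_on_enum) (simp add: assms(3))
  define i where "i = inv_into {..<?k} (\<lambda>n. (f ^^ n) s)"
  have i: "i ((f ^^ n) s) = n" if "n < ?k" for n
    unfolding i_def using s(1) that by (intro inv_into_f_f) (auto simp: bij_betw_def)
  define h where "h x = (g ^^ i x) t" for x
  \<comment> \<open>The bound includes \<open>n = ?k\<close>, where both cycles are back at their
    base points; this covers the step from the last point to the first.\<close>
  have h: "h ((f ^^ n) s) = (g ^^ n) t" if "n \<le> ?k" for n
  proof (cases "n = ?k")
    case True
    have "0 < ?k" using assms(1) finite_cyclic_on[OF assms(1)]
      by (auto simp: cyclic_on_def card_gt_0_iff)
    then show ?thesis using True i[of 0] s(2) t(2) by (simp add: h_def)
  next
    case False
    then show ?thesis using that i[of n] by (simp add: h_def)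
  qed
  have "bij_betw h S T"
  proof -
    have "bij_betw i S {..<?k}" unfolding i_def using s(1) by (rule bij_betw_inv_into)
    then have "bij_betw ((\<lambda>n. (g ^^ n) t) \<circ> i) S T" using t(1) by (rule bij_betw_trans)
    then show ?thesis by (simp add: h_def[abs_def] o_def)
  qed
  moreover have "h (f x) = g (h x)" if x: "x \<in> S" for x
  proof -
    obtain n where n: "n < ?k" "x = (f ^^ n) s" using x s(1) by (auto simp: bij_betw_def)
    then show ?thesis using h[of n] h[of "Suc n"] by simp
  qed
  ultimately show ?thesis by (rule that)
qed

text \<open>\<open>orbit p x\<close> is generated starting from \<open>p x\<close>; it returns to
  \<open>x\<close> because a permutation of a finite set has finite order.\<close>

lemma self_in_orbit:
  assumes "finite V" "p permutes V"
  shows "x \<in> orbit p x"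
  using assms by (intro permutation_self_in_orbit) (auto simp: permutation_permutes)

lemma orbits_disjoint:
  assumes "finite V" "p permutes V" "P \<in> orbits V p" "Q \<in> orbits V p" "x \<in> P" "x \<in> Q"
  shows "P = Q"
proof -
  have "cyclic_on p P" "cyclic_on p Q"
    using assms cyclic_on_orbit[OF assms(2,1)] by (auto simp: orbits_def)
  then show ?thesis using assms(5,6) by (metis orbit_cyclic_eq3)
qed

lemma Union_orbits:
  assumes "finite V" "p permutes V"
  shows "\<Union> (orbits V p) = V"
  using permutes_orbit_subset[OF assms(2)] self_in_orbit[OF assms] unfolding orbits_def by fast

lemma sum_card_orbits:
  assumes "finite V" "p permutes V"
  shows "(\<Sum>P\<in>orbits V p. card P) = card V"
proof -
  have "card (\<Union> (orbits V p)) = (\<Sum>P\<in>orbits V p. card P)"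
  proof (rule card_Union_disjoint)
    show "pairwise disjnt (orbits V p)"
      using orbits_disjoint[OF assms] by (auto simp: pairwise_def disjnt_def)
    show "finite P" if "P \<in> orbits V p" for P
      using that Union_orbits[OF assms] assms(1) by (metis Union_upper finite_subset)
  qed
  then show ?thesis by (simp add: Union_orbits[OF assms])
qed

lemma image_orbit:
  assumes "finite V" "p permutes V" "P \<in> orbits V p"
  shows "p ` P = P"
proof -
  have c: "cyclic_on p P" using assms cyclic_on_orbit[OF assms(2,1)] by (auto simp: orbits_def)
  then have "p ` P \<subseteq> P" by (auto intro: cyclic_on_inI)
  moreover have "finite P" using c by (rule finite_cyclic_on)
  moreover have "inj_on p P" using assms(2) by (meson permutes_inj inj_on_subset subset_UNIV)
  ultimately show ?thesis by (simp add: endo_inj_surj)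
qed

text \<open>
  Every set of a \<open>p\<close>-stable covering contains an orbit of \<open>p\<close>; if \<open>p\<close> has no more orbits than the
  covering has sets, then each set is a single orbit.
\<close>

lemma conj_of_stable_cover:
  assumes V: "finite V" and r: "r permutes V" and p: "p permutes V"
    and Y: "Y \<in> stable_covers (orbits V r) card V p"
    and le: "card (orbits V p) \<le> card (orbits V r)"
  obtains t where "t permutes V" and "p = t \<circ> r \<circ> inv_into UNIV t"
proof -
  let ?J = "orbits V r"
  have finJ: "finite ?J" and finP: "finite (orbits V p)" using V by (simp_all add: orbits_def)
  have cyc: "cyclic_on r P" if "P \<in> ?J" for P
    using that cyclic_on_orbit[OF r V] by (auto simp: orbits_def)
  have Ycov: "Y \<in> covers ?J card V" and Ystab: "\<And>P. P \<in> ?J \<Longrightarrow> p ` Y P = Y P"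
    using Y by (auto simp: stable_covers_def)
  have Ysub: "Y P \<subseteq> V" "card (Y P) = card P" if "P \<in> ?J" for P
    using Ycov that by (auto simp: covers_def PiE_iff)
  have YU: "(\<Union>P\<in>?J. Y P) = V" using Ycov by (simp add: covers_def)
  \<comment> \<open>The orbit sizes of \<open>r\<close> add up to \<open>card V\<close>, so the
    covering is a partition.\<close>
  have disj: "disjoint_family_on Y ?J"
    using disjoint_covers[OF V finJ sum_card_orbits[OF V r] Ycov] .
  have uniq: "P = Q" if "P \<in> ?J" "Q \<in> ?J" "x \<in> Y P" "x \<in> Y Q" for P Q x
    using disj that by (auto simp: disjoint_family_on_def)
  have "\<exists>y. y \<in> Y P" if "P \<in> ?J" for P
  proof -
    have "card P > 0"
      using cyc[OF that] finite_cyclic_on[OF cyc[OF that]]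
      by (auto simp: cyclic_on_def card_gt_0_iff)
    then show ?thesis using Ysub(2)[OF that] by (metis card.empty ex_in_conv less_irrefl)
  qed
  then obtain y where y: "\<And>P. P \<in> ?J \<Longrightarrow> y P \<in> Y P" by metis
  \<comment> \<open>\<open>c P\<close> is one orbit of \<open>p\<close> inside the block
    \<open>Y P\<close>; disjoint blocks give distinct orbits.\<close>
  define c where "c P = orbit p (y P)" for P
  have self: "x \<in> orbit p x" for x
    by (rule self_in_orbit[OF V p])
  have csub: "c P \<subseteq> Y P" if "P \<in> ?J" for P
    unfolding c_def using Ystab[OF that] y[OF that] by (intro orbit_subset_stable) auto
  have "inj_on c ?J"
  proof (rule inj_onI)
    fix P Q assume "P \<in> ?J" "Q \<in> ?J" "c P = c Q"
    then show "P = Q" using uniq[of P Q "y P"] csub self[of "y P"] y by (auto simp: c_def)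
  qed
  moreover have cim: "c ` ?J \<subseteq> orbits V p"
    using y Ysub by (auto simp: c_def orbits_def)
  \<comment> \<open>\<open>p\<close> has at most as many orbits as there are blocks, so the
    injective choice \<open>c\<close> exhausts them.\<close>
  ultimately have "c ` ?J = orbits V p"
    using le finP by (intro card_seteq) (simp_all add: card_image)
  have Yc: "Y P = c P" if "P \<in> ?J" for P
  proof
    show "Y P \<subseteq> c P"
    proof
      fix x assume x: "x \<in> Y P"
      then have "orbit p x \<in> c ` ?J"
        using Ysub(1)[OF that] \<open>c ` ?J = _\<close> by (auto simp: orbits_def)
      then obtain Q where Q: "Q \<in> ?J" "orbit p x = c Q" by auto
      then have "x \<in> Y Q" using csub[OF Q(1)] self[of x] by auto
      then have "P = Q" using uniq[OF that Q(1) x] by simp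
      then show "x \<in> c P" using Q self[of x] by simp
    qed
  qed (rule csub[OF that])
  have "\<exists>h. bij_betw h P (Y P) \<and> (\<forall>x\<in>P. h (r x) = p (h x))" if "P \<in> ?J" for P
  proof -
    have "cyclic_on p (Y P)" unfolding Yc[OF that] c_def by (rule cyclic_on_orbit[OF p V])
    then show ?thesis using cyclic_on_bij[OF cyc[OF that]] Ysub(2)[OF that] by metis
  qed
  then obtain h where h: "\<And>P. P \<in> ?J \<Longrightarrow> bij_betw (h P) P (Y P)"
      "\<And>P x. P \<in> ?J \<Longrightarrow> x \<in> P \<Longrightarrow> h P (r x) = p (h P x)" by metis
  \<comment> \<open>The conjugating permutation is glued from the matchings of the cycles of
    \<open>r\<close> with those of \<open>p\<close>, and is the identity outside
    \<open>V\<close>.\<close>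
  define t where "t x = (if x \<in> V then h (orbit r x) x else x)" for x
  have selfr: "x \<in> orbit r x" for x
    by (rule self_in_orbit[OF V r])
  have J: "orbit r x \<in> ?J" if "x \<in> V" for x using that by (simp add: orbits_def)
  have t_eq: "t x = h P x" if "P \<in> ?J" "x \<in> P" for P x
  proof -
    have "x \<in> V" using that Union_orbits[OF V r] by auto
    moreover have "orbit r x = P" using orbit_cyclic_eq3[OF cyc] that by blast
    ultimately show ?thesis by (simp add: t_def)
  qed
  have "t ` V = V"
  proof -
    have "t ` V = t ` \<Union> ?J" by (simp add: Union_orbits[OF V r])
    also have "\<dots> = (\<Union>P\<in>?J. h P ` P)"
      unfolding image_Union by (intro SUP_cong image_cong) (simp_all add: t_eq)
    also have "\<dots> = V" using h(1) YU by (simp add: bij_betw_def)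
    finally show ?thesis .
  qed
  then have "bij_betw t V V" using V by (simp add: bij_betw_def finite_surj_inj)
  then have t: "t permutes V" by (rule bij_imp_permutes) (simp add: t_def)
  moreover have "p = t \<circ> r \<circ> inv_into UNIV t"
  proof
    fix x
    define z where "z = inv_into UNIV t x"
    have x: "x = t z" by (simp add: z_def permutes_inverses[OF t])
    have "t (r z) = p (t z)"
    proof (cases "z \<in> V")
      case True
      have "r z \<in> orbit r z" by (rule orbit.base)
      then show ?thesis
        using t_eq[OF J[OF True] selfr] t_eq[OF J[OF True]] h(2)[OF J[OF True] selfr] by simp
    next
      case False
      then show ?thesis using permutes_not_in[OF r False] permutes_not_in[OF p False]
        permutes_not_in[OF t False] by simp
    qed
    then show "p x = (t \<circ> r \<circ> inv_into UNIV t) x" by (simp add: x permutes_inverses[OF t])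
  qed
  ultimately show ?thesis by (rule that)
qed

text \<open>The orbits of \<open>p\<close> themselves form such a covering. This makes the diagonal
  coefficients of the triangular system positive.\<close>

lemma stable_covers_self:
  assumes "finite V" "p permutes V"
  shows "stable_covers (orbits V p) card V p \<noteq> {}"
proof -
  have "(\<lambda>P\<in>orbits V p. P) \<in> stable_covers (orbits V p) card V p"
    using Union_orbits[OF assms] image_orbit[OF assms]
    by (auto simp: stable_covers_def covers_def PiE_iff)
  then show ?thesis by blast
qed

text \<open>The orbit sizes of a permutation \<open>r\<close>, taken as block sizes, give a linear
  equation for the differences of the conjugacy sums. Differences at permutations with more orbits
  vanish by induction, and the others have coefficient 0 unless they belong to conjugates of
  \<open>r\<close>. What remains is a nonzero multiple of the difference at
  \<open>r\<close>.\<close>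

theorem same_deck_conj_sum:
  fixes A B :: "'a \<Rightarrow> 'a \<Rightarrow> 'b::{idom, ring_char_0}"
  assumes deck: "same_deck A B V" and V: "finite V"
    and "p permutes V" and "card (orbits V p) \<ge> 2"
  shows "conj_sum A V p = conj_sum B V p"
  using assms(3,4)
proof (induction "card V - card (orbits V p)" arbitrary: p rule: less_induct)
  case (less r)
  let ?J = "orbits V r"
  let ?a = "\<lambda>p. card (stable_covers ?J card V p)"
  let ?f = "\<lambda>p. of_int (sign p * int (?a p)) :: 'b"
  let ?d = "\<lambda>p. conj_sum A V p - conj_sum B V p"
  let ?S = "{p. p permutes V \<and> card (orbits V p) \<le> card ?J}"
  have r: "r permutes V" by fact
  have fin: "finite {p. p permutes V}" using V by (rule finite_permutations)
  have finJ: "finite ?J" using V by (simp add: orbits_def)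
  \<comment> \<open>With at least two orbits none is all of \<open>V\<close>, so that only minors
    visible in the deck occur.\<close>
  have small: "card P < card V" if "P \<in> ?J" for P
  proof -
    have "P \<subseteq> V" using that Union_orbits[OF V r] by auto
    moreover have "P \<noteq> V"
    proof
      assume "P = V"
      then have "Q = P" if Q: "Q \<in> ?J" for Q
      proof -
        obtain x where "x \<in> V" "Q = orbit r x" using Q by (auto simp: orbits_def)
        then have "x \<in> Q" "x \<in> P" using \<open>P = V\<close> self_in_orbit[OF V r] by simp_all
        then show ?thesis using orbits_disjoint[OF V r that \<open>P \<in> ?J\<close>] by blast
      qed
      then have "?J = {P}" using that by blast
      then show False using less.prems(2) by simp
    qed
    ultimately show ?thesis using V by (simp add: psubset_card_mono psubset_eq)
  qed
  have cls: "?f (t \<circ> p \<circ> inv_into UNIV t) = ?f p" if "t permutes V" "p permutes V" for t p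
    using sign_conj[OF V that] card_stable_covers_conj[OF V finJ that(1)] by simp
  have D: "(\<Sum>p | p permutes V. ?f p * conj_sum C V p)
      = of_nat (fact (card V)) * (\<Sum>Y\<in>covers ?J card V. \<Prod>j\<in>?J. pdet C (Y j))"
    for C :: "'a \<Rightarrow> 'a \<Rightarrow> 'b"
    using sum_class_function[OF V, of ?f C] cls
      sum_covers_eq_sum_permutes[OF V finJ sum_card_orbits[OF V r], of C] by simp
  have "(\<Sum>p | p permutes V. ?f p * conj_sum A V p) = (\<Sum>p | p permutes V. ?f p * conj_sum B V p)"
    unfolding D using same_deck_covers[OF deck V finJ small] by simp
  then have "0 = (\<Sum>p | p permutes V. ?f p * ?d p)"
    by (simp add: right_diff_distrib sum_subtractf)
  also have "\<dots> = (\<Sum>p\<in>?S. of_int (sign r * int (?a p)) * ?d r)"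
  proof (rule sum.mono_neutral_cong_right[OF fin])
    show "\<forall>p\<in>{p. p permutes V} - ?S. ?f p * ?d p = 0"
    proof
      fix p assume p: "p \<in> {p. p permutes V} - ?S"
      then have "card ?J < card (orbits V p)" by auto
      moreover have "card (orbits V p) \<le> card V" using V by (simp add: orbits_def card_image_le)
      ultimately have "conj_sum A V p = conj_sum B V p"
        using p less.prems(2) by (intro less.hyps) auto
      then show "?f p * ?d p = 0" by simp
    qed
    fix p assume p: "p \<in> ?S"
    show "?f p * ?d p = of_int (sign r * int (?a p)) * ?d r"
    proof (cases "stable_covers ?J card V p = {}")
      case False
      then obtain Y where "Y \<in> stable_covers ?J card V p" by blast
      then obtain t where t: "t permutes V" "p = t \<circ> r \<circ> inv_into UNIV t"
        using conj_of_stable_cover[OF V r] p by blast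
      then show ?thesis using sign_conj[OF V t(1) r] by (simp add: conj_sum_conj)
    qed simp
  qed auto
  also have "\<dots> = of_int (sign r) * of_nat (\<Sum>p\<in>?S. ?a p) * ?d r"
    by (simp add: sum_distrib_left sum_distrib_right mult.assoc)
  finally have "of_int (sign r) * of_nat (\<Sum>p\<in>?S. ?a p) * ?d r = 0" by simp
  moreover have "of_int (sign r) \<noteq> (0 :: 'b)" by simp
  \<comment> \<open>All remaining terms carry the sign of \<open>r\<close>, so their counts add
    without cancellation, and \<open>r\<close> itself contributes a positive one.\<close>
  moreover have "(\<Sum>p\<in>?S. ?a p) \<noteq> 0"
  proof -
    have "?a r \<noteq> 0"
      using stable_covers_self[OF V r] finite_stable_covers[OF V finJ] by (simp add: card_eq_0_iff)
    moreover have "r \<in> ?S" "finite ?S" using r fin by auto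
    ultimately show ?thesis by (auto simp: sum_eq_0_iff)
  qed
  then have "of_nat (\<Sum>p\<in>?S. ?a p) \<noteq> (0 :: 'b)" by (simp only: of_nat_eq_0_iff) simp
  ultimately have "?d r = 0" by simp
  then show ?case by simp
qed

section \<open>Adjacency matrices and vertices of degree 1\<close>

definition adj :: "('a, 'b) pre_digraph \<Rightarrow> 'a \<Rightarrow> 'a \<Rightarrow> int" where
  "adj G x y = (if (x, y) \<in> arcs_ends G then 1 else 0)"

lemma pchar_poly_cong:
  assumes "\<And>x y. x \<in> X \<Longrightarrow> y \<in> X \<Longrightarrow> A x y = B x y"
  shows "pchar_poly A X = pchar_poly B X"
proof -
  have "pdet A Y = pdet B Y" if "Y \<subseteq> X" for Y
    using that assms by (intro pdet_cong) auto
  then show ?thesis unfolding pchar_poly_def by (intro sum.cong) auto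
qed

lemma graph_char_poly_eq_pchar_poly:
  assumes "finite (verts G)"
  shows "graph_char_poly G = pchar_poly (adj G) (verts G)"
proof -
  define vs where "vs = (SOME vs. distinct vs \<and> set vs = verts G)"
  have "\<exists>vs. distinct vs \<and> set vs = verts G" using finite_distinct_list[OF assms] by blast
  then have "distinct vs \<and> set vs = verts G" unfolding vs_def by (rule someI_ex)
  then show ?thesis
    using char_poly_eq_pchar_poly[of vs "adj G"]
    by (simp add: graph_char_poly_def adjacency_matrix_def adj_def vs_def[symmetric])
qed

lemma graph_char_poly_induce_subgraph:
  assumes "finite X"
  shows "graph_char_poly (G \<restriction> X) = pchar_poly (adj G) X"
proof -
  have "(x, y) \<in> arcs_ends (G \<restriction> X) \<longleftrightarrow> (x, y) \<in> arcs_ends G" if "x \<in> X" "y \<in> X" for x y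
    using that by (auto simp: arcs_ends_conv)
  then show ?thesis
    using assms by (subst graph_char_poly_eq_pchar_poly) (auto simp: adj_def intro: pchar_poly_cong)
qed

lemma complete_poly_deck_eq:
  assumes V: "finite (verts G)"
  shows "complete_poly_deck G = image_mset (pchar_poly (adj G)) (mset_set {X. X \<subset> verts G})"
proof -
  let ?D = "{S. S \<noteq> {} \<and> S \<subseteq> verts G}"
  have "inj_on (\<lambda>S. verts G - S) ?D" by (rule inj_onI) (simp, blast)
  moreover have "(\<lambda>S. verts G - S) ` ?D = {X. X \<subset> verts G}"
  proof (rule Set.set_eqI)
    fix X
    have "X = verts G - (verts G - X)" "verts G - X \<in> ?D" if "X \<subset> verts G"
      using that by auto
    then show "X \<in> (\<lambda>S. verts G - S) ` ?D \<longleftrightarrow> X \<in> {X. X \<subset> verts G}" by blast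
  qed
  ultimately have *: "mset_set {X. X \<subset> verts G} = image_mset (\<lambda>S. verts G - S) (mset_set ?D)"
    using image_mset_mset_set by metis
  show ?thesis
    unfolding complete_poly_deck_def * image_mset.compositionality o_def
    using V by (simp add: graph_char_poly_induce_subgraph)
qed

text \<open>Pulling the polynomials back along \<open>k\<close> to an index set \<open>W\<close>
  lets \<open>same_deck\<close> compare graphs with different vertex types.\<close>

lemma complete_poly_deck_reindex:
  assumes W: "finite W" and k: "bij_betw k W (verts G)"
  shows "complete_poly_deck G
    = image_mset (pchar_poly (\<lambda>x y. adj G (k x) (k y))) (mset_set {X. X \<subset> W})"
proof -
  have V: "finite (verts G)" using k W bij_betw_finite by blast
  have inj: "inj_on k W" and im: "k ` W = verts G" using k by (auto simp: bij_betw_def)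
  have "inj_on ((`) k) {X. X \<subset> W}"
    using inj_on_image_Pow[OF inj] by (rule inj_on_subset) auto
  moreover have "(`) k ` {X. X \<subset> W} = {X. X \<subset> verts G}"
  proof (rule Set.set_eqI, rule iffI)
    fix Y assume "Y \<in> (`) k ` {X. X \<subset> W}"
    then obtain X where "X \<subset> W" "Y = k ` X" by auto
    then have "Y \<subseteq> k ` W" "Y \<noteq> k ` W" using inj_on_image_eq_iff[OF inj, of X W] by auto
    then show "Y \<in> {X. X \<subset> verts G}" by (auto simp: im)
  next
    fix Y assume "Y \<in> {X. X \<subset> verts G}"
    then have Y: "Y \<subset> k ` W" by (simp add: im)
    then obtain X where "X \<subseteq> W" "Y = k ` X" by (meson psubset_imp_subset subset_imageE)
    then show "Y \<in> (`) k ` {X. X \<subset> W}" using Y by auto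
  qed
  ultimately have *: "mset_set {X. X \<subset> verts G} = image_mset ((`) k) (mset_set {X. X \<subset> W})"
    using image_mset_mset_set by metis
  have "pchar_poly (adj G) (k ` X) = pchar_poly (\<lambda>x y. adj G (k x) (k y)) X" if "X \<subset> W" for X
  proof (rule pchar_poly_reindex[symmetric])
    show "finite X" using that W finite_subset by blast
    show "bij_betw k X (k ` X)" using that inj by (meson inj_on_imp_bij_betw inj_on_subset psubset_imp_subset)
  qed
  then show ?thesis
    unfolding complete_poly_deck_eq[OF V] * image_mset.compositionality o_def
    using finite_psubsets[OF W] by (intro image_mset_cong) simp
qed

lemma same_deck_adj:
  assumes "finite W" "bij_betw k W (verts G)" "bij_betw k' W (verts G')"
    and "complete_poly_deck G' = complete_poly_deck G"
  shows "same_deck (\<lambda>x y. adj G (k x) (k y)) (\<lambda>x y. adj G' (k' x) (k' y)) W"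
  unfolding same_deck_def
  using assms(4) unfolding complete_poly_deck_reindex[OF assms(1,2)]
    complete_poly_deck_reindex[OF assms(1,3)] by (rule sym)

text \<open>There is one card for each proper subset of the \<open>n\<close> vertices,
  \<open>2 ^ n - 1\<close> in all, and this number determines \<open>n\<close>.\<close>

lemma card_verts_eq_of_deck:
  assumes "finite (verts G)" "finite (verts G')"
    and "complete_poly_deck G' = complete_poly_deck G"
  shows "card (verts G') = card (verts G)"
proof -
  have *: "size (complete_poly_deck H) = 2 ^ card (verts H) - 1" if H: "finite (verts H)"
    for H :: "('e, 'f) pre_digraph"
  proof -
    have "{X. X \<subset> verts H} = Pow (verts H) - {verts H}" by auto
    then show ?thesis using H by (simp add: complete_poly_deck_eq card_Pow)
  qed
  have "(2::nat) ^ card (verts G') - 1 = 2 ^ card (verts G) - 1"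
    using *[OF assms(1)] *[OF assms(2)] assms(3) by simp
  moreover have "(1::nat) \<le> 2 ^ n" for n by simp
  ultimately have "(2::nat) ^ card (verts G') = 2 ^ card (verts G)"
    by (metis le_add_diff_inverse)
  then show ?thesis by simp
qed

section \<open>Vertices of degree 1\<close>

lemma pdet_doubleton:
  assumes "u \<noteq> v"
  shows "pdet A {u, v} = A u u * A v v - A u v * A v u"
proof -
  have "{p. p permutes {u, v}} = {id, Transposition.transpose u v}"
    using assms by (auto simp: permutes_doubleton_iff)
  moreover have "id \<noteq> Transposition.transpose u v"
    using assms by (metis id_apply transpose_apply_first)
  ultimately show ?thesis
    using assms by (simp add: pdet_def sign_swap_id)
qed

definition zero_one_symmetric :: "('a \<Rightarrow> 'a \<Rightarrow> int) \<Rightarrow> 'a set \<Rightarrow> bool" where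
  "zero_one_symmetric A V \<longleftrightarrow>
     (\<forall>x\<in>V. A x x = 0 \<and> (\<forall>y\<in>V. A x y \<in> {0, 1} \<and> A x y = A y x))"

text \<open>A minor of size 2 is -1 on an edge and 0 on a non-edge, so \<open>minor_sum A 2\<close>
  is minus the number of edges; deleting \<open>v\<close> loses as many edges as the degree of
  \<open>v\<close>.\<close>

lemma minor_sum_2_diff:
  assumes A: "zero_one_symmetric A V" and V: "finite V" and v: "v \<in> V"
  shows "minor_sum A 2 (V - {v}) = minor_sum A 2 V + (\<Sum>u\<in>V. A v u)"
proof -
  let ?N = "{Y. Y \<subseteq> V \<and> card Y = 2}" and ?M = "{Y. Y \<subseteq> V - {v} \<and> card Y = 2}"
  have pair: "Y \<in> ?N - ?M \<longleftrightarrow> Y \<in> (\<lambda>u. {v, u}) ` (V - {v})" for Y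
  proof
    assume "Y \<in> ?N - ?M"
    then have Y: "Y \<subseteq> V" "card Y = 2" "v \<in> Y" by auto
    then obtain u where "Y = {v, u}" "u \<noteq> v"
      by (auto simp: card_2_iff insert_commute)
    then show "Y \<in> (\<lambda>u. {v, u}) ` (V - {v})" using Y by auto
  qed (use v in auto)
  have fin: "finite ?N" using V by simp
  have inj: "inj_on (\<lambda>u. {v, u}) (V - {v})" by (auto simp: inj_on_def doubleton_eq_iff)
  have "minor_sum A 2 V = minor_sum A 2 (V - {v}) + (\<Sum>Y\<in>?N - ?M. pdet A Y)"
  proof -
    have "?M \<subseteq> ?N" by blast
    then show ?thesis
      unfolding minor_sum_def by (simp only: sum.subset_diff[of ?M ?N] fin add.commute)
  qed
  also have "?N - ?M = (\<lambda>u. {v, u}) ` (V - {v})" by (rule Set.set_eqI, rule pair)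
  also have "(\<Sum>Y\<in>(\<lambda>u. {v, u}) ` (V - {v}). pdet A Y) = (\<Sum>u\<in>V - {v}. - A v u)"
  proof (subst sum.reindex[OF inj], rule sum.cong[OF refl])
    fix u assume u: "u \<in> V - {v}"
    then have "A v v = 0" "A v u * A u v = A v u" "v \<noteq> u"
      using A v by (auto simp: zero_one_symmetric_def)
    then show "(pdet A \<circ> (\<lambda>u. {v, u})) u = - A v u" using pdet_doubleton[of v u A] by simp
  qed
  also have "\<dots> = - (\<Sum>u\<in>V. A v u)"
    using A v sum.remove[OF V v, of "A v"] by (simp add: sum_negf zero_one_symmetric_def)
  finally show ?thesis by simp
qed

text \<open>The deck determines the number of edges, as 2 is below \<open>card V\<close>. A card
  with one vertex deleted and exactly one edge less therefore reveals a vertex of degree 1.\<close>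

lemma same_deck_leaf:
  assumes deck: "same_deck A B V" and V: "finite V" "card V \<ge> 3"
    and A: "zero_one_symmetric A V" and B: "zero_one_symmetric B V"
    and leaf: "\<exists>v\<in>V. (\<Sum>u\<in>V. A v u) = 1"
  shows "\<exists>v\<in>V. (\<Sum>u\<in>V. B v u) = 1"
proof -
  let ?P = "\<lambda>p. degree p = card V - 1 \<and> signed_coeff 2 p = minor_sum A 2 V + 1"
  have fin: "finite {X. X \<subset> V}" using V(1) by (rule finite_psubsets)
  have eq: "minor_sum A 2 V = minor_sum B 2 V" using deck V by (intro same_deck_minor_sum) auto
  obtain v where v: "v \<in> V" "(\<Sum>u\<in>V. A v u) = 1" using leaf by blast
  then have "?P (pchar_poly A (V - {v}))"
    using V(1) minor_sum_2_diff[OF A V(1) v(1)] by (simp add: signed_coeff_pchar_poly)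
  then have "(\<Sum>X | X \<subset> V. if ?P (pchar_poly A X) then 1 else 0 :: nat) \<noteq> 0"
    using fin v(1) by (subst sum_eq_0_iff) auto
  then have "(\<Sum>X | X \<subset> V. if ?P (pchar_poly B X) then 1 else 0 :: nat) \<noteq> 0"
    using same_deck_sum[OF deck, of "\<lambda>p. if ?P p then 1 else 0 :: nat"] by simp
  then obtain X where X: "X \<subset> V" "?P (pchar_poly B X)"
    by (elim sum.not_neutral_contains_not_neutral) (auto split: if_splits)
  have finX: "finite X" using X V finite_subset by blast
  have "card (V - X) = 1"
    using X V finX by (simp add: card_Diff_subset psubset_imp_subset)
  then obtain w where "V - X = {w}" by (auto simp: card_1_singleton_iff)
  then have w: "w \<in> V" "X = V - {w}" using X by auto
  then have "(\<Sum>u\<in>V. B w u) = 1"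
    using X(2) minor_sum_2_diff[OF B V(1) w(1)] eq finX by (simp add: signed_coeff_pchar_poly)
  then show ?thesis using w by blast
qed

lemma leaf_unique:
  assumes A: "zero_one_symmetric A V" and V: "finite V" and v: "v \<in> V" "(\<Sum>u\<in>V. A v u) = 1"
    and x: "x \<in> V" "A v x \<noteq> 0" and y: "y \<in> V" "A v y \<noteq> 0"
  shows "x = y"
proof (rule ccontr)
  assume "x \<noteq> y"
  have "A v x = 1" "A v y = 1" using A v x y by (auto simp: zero_one_symmetric_def)
  then have "2 = (\<Sum>u\<in>{x, y}. A v u)" using \<open>x \<noteq> y\<close> by simp
  also have "\<dots> \<le> (\<Sum>u\<in>V. A v u)"
  proof (rule sum_mono2)
    fix u assume "u \<in> V - {x, y}"
    then have "A v u \<in> {0, 1}" using A v(1) unfolding zero_one_symmetric_def by blast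
    then show "0 \<le> A v u" by auto
  qed (use V x y in auto)
  finally show False using v by simp
qed

text \<open>On a Hamiltonian cycle with at least three vertices every vertex has two distinct
  neighbours, its predecessor and its successor. A nonzero summand would give two such neighbours to
  \<open>v\<close>, which has only one.\<close>

lemma conj_sum_leaf:
  assumes A: "zero_one_symmetric A V" and V: "finite V" "card V \<ge> 3"
    and v: "v \<in> V" "(\<Sum>u\<in>V. A v u) = 1"
    and p: "p permutes V" and orb: "card (orbits V p) \<le> 1"
  shows "conj_sum A V p = 0"
  unfolding conj_sum_def
proof (rule sum.neutral, rule ballI, rule ccontr)
  fix t assume "t \<in> {t. t permutes V}"
  then have t: "t permutes V" by simp
  assume nz: "perm_weight A V (t \<circ> p \<circ> inv_into UNIV t) \<noteq> 0"
  have edge: "A (t x) (t (p x)) \<noteq> 0" if "x \<in> V" for x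
    using nz that V(1) by (auto simp: perm_weight_conj[OF t] prod_zero_iff)
  \<comment> \<open>\<open>x\<close> is the point sent to the leaf, and \<open>w\<close> is its
    predecessor under \<open>p\<close>.\<close>
  define x where "x = inv_into UNIV t v"
  define w where "w = inv_into UNIV p x"
  have x: "x \<in> V" "t x = v" using permutes_in_image[OF permutes_inv[OF t]] v(1)
    by (auto simp: x_def permutes_inverses[OF t])
  have w: "w \<in> V" "p w = x" using permutes_in_image[OF permutes_inv[OF p]] x(1)
    by (auto simp: w_def permutes_inverses[OF p])
  have V': "t (p x) \<in> V" "t w \<in> V" using x w t p by (simp_all add: permutes_in_image)
  have "A v (t (p x)) \<noteq> 0" using edge[OF x(1)] x(2) by simp
  moreover have "A v (t w) \<noteq> 0" using edge[OF w(1)] w x V' A v(1) by (simp add: zero_one_symmetric_def)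
  ultimately have "t (p x) = t w" using leaf_unique[OF A V(1) v] V' by blast
  then have "p x = w" using permutes_inj[OF t] by (simp add: inj_eq)
  \<comment> \<open>Successor and predecessor coincide, so the only orbit has at most two points,
    too few for \<open>V\<close>.\<close>
  then have "(p ^^ 2) x = x" using w(2) by (simp add: numeral_2_eq_2)
  then have "orbit p x = {(p ^^ m) x | m. m < 2}" by (rule orbit_altdef_bounded) simp
  also have "\<dots> \<subseteq> {x, p x}" by (auto simp: less_2_cases_iff)
  finally have "card (orbit p x) \<le> card {x, p x}" by (intro card_mono) auto
  also have "\<dots> \<le> 2" by (simp add: card_insert_if)
  finally have "card (orbit p x) \<le> 2" .
  moreover have "orbit p x = V"
  proof -
    have "finite (orbits V p)" "orbit p x \<in> orbits V p" using V x(1) by (auto simp: orbits_def)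
    then have "orbits V p = {orbit p x}" using orb card_le_Suc0_iff_eq[of "orbits V p"] by auto
    then show ?thesis using Union_orbits[OF V(1) p] by simp
  qed
  ultimately show False using V(2) by simp
qed

text \<open>Permutations with two or more orbits have equal conjugacy sums by the deck; the cyclic
  ones contribute 0 on both sides, because a leaf of \<open>A\<close> forces one of
  \<open>B\<close>. This gives the determinant; every other coefficient comes from minors of size
  below \<open>card V\<close>.\<close>

lemma pchar_poly_eq_of_leaf:
  assumes deck: "same_deck A B V" and V: "finite V" "card V \<ge> 3"
    and A: "zero_one_symmetric A V" and B: "zero_one_symmetric B V"
    and leaf: "\<exists>v\<in>V. (\<Sum>u\<in>V. A v u) = 1"
  shows "pchar_poly A V = pchar_poly B V"
proof -
  obtain v where v: "v \<in> V" "(\<Sum>u\<in>V. A v u) = 1" using leaf by blast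
  obtain w where w: "w \<in> V" "(\<Sum>u\<in>V. B w u) = 1" using same_deck_leaf[OF assms] by blast
  have eq: "conj_sum A V p = conj_sum B V p" if p: "p permutes V" for p
  proof (cases "card (orbits V p) \<ge> 2")
    case True
    then show ?thesis by (rule same_deck_conj_sum[OF deck V(1) p])
  next
    case False
    then show ?thesis using conj_sum_leaf[OF A V v p] conj_sum_leaf[OF B V w p] by simp
  qed
  have "of_nat (fact (card V)) * pdet A V = of_nat (fact (card V)) * pdet B V"
    unfolding sum_sign_conj_sum[OF V(1), symmetric] by (intro sum.cong) (auto simp: eq)
  then have "pdet A V = pdet B V" by simp
  then have "minor_sum A r V = minor_sum B r V" if "r \<le> card V" for r
    using that same_deck_minor_sum[OF deck V(1)] minor_sum_card[OF V(1), of A]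
      minor_sum_card[OF V(1), of B]
    by (cases "r = card V") auto
  moreover have "coeff (pchar_poly C V) k
      = (if k \<le> card V then (-1) ^ (card V - k) * minor_sum C (card V - k) V else 0)"
    for C :: "'a \<Rightarrow> 'a \<Rightarrow> int" and k
    using coeff_pchar_poly[OF V(1), of "card V - k" C] V(1) by (auto intro: coeff_eq_0)
  ultimately show ?thesis by (intro poly_eqI) simp
qed

section \<open>Embeddings and subgraph counts\<close>

text \<open>Bijectivity makes the image a spanning subgraph, which need not be induced.
  \<open>extensional\<close> lets each map be counted once.\<close>

definition embeddings :: "('e, 'f) pre_digraph \<Rightarrow> ('a, 'b) pre_digraph \<Rightarrow> ('e \<Rightarrow> 'a) set" where
  "embeddings F G = {t \<in> extensional (verts F). bij_betw t (verts F) (verts G) \<and>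
     (\<forall>x\<in>verts F. \<forall>y\<in>verts F. (x, y) \<in> arcs_ends F \<longrightarrow> (t x, t y) \<in> arcs_ends G)}"

text \<open>Vertex maps suffice, because without parallel arcs they determine the arc map.\<close>

definition isomorphisms :: "('e, 'f) pre_digraph \<Rightarrow> ('a, 'b) pre_digraph \<Rightarrow> ('e \<Rightarrow> 'a) set" where
  "isomorphisms F G = {t \<in> extensional (verts F). bij_betw t (verts F) (verts G) \<and>
     (\<forall>x\<in>verts F. \<forall>y\<in>verts F. (x, y) \<in> arcs_ends F \<longleftrightarrow> (t x, t y) \<in> arcs_ends G)}"

lemma digraph_iso_imp_isomorphisms:
  assumes "wf_digraph H" "digraph_iso H F"
  shows "isomorphisms F H \<noteq> {}"
proof -
  obtain f where f: "pre_digraph.digraph_isomorphism H f" and F: "F = app_iso f H"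
    using assms(2) by (auto simp: digraph_iso_def)
  let ?g = "iso_verts f"
  have inj: "inj_on ?g (verts H)"
    using f by (rule pre_digraph.digraph_isomorphism_inj_on_verts)
  have vF: "verts F = ?g ` verts H" by (simp add: F)
  then have g: "bij_betw ?g (verts H) (verts F)" using inj by (simp add: bij_betw_def)
  have aF: "arcs_ends F = (\<lambda>(u, v). (?g u, ?g v)) ` arcs_ends H"
    unfolding F using f by (rule wf_digraph.arcs_ends_app_iso_eq[OF assms(1)])
  \<comment> \<open>\<open>digraph_iso H F\<close> provides a map from \<open>H\<close> to
    \<open>F\<close>, so its inverse is taken.\<close>
  define t where "t = restrict (inv_into (verts H) ?g) (verts F)"
  have tg: "t (?g x) = x" if "x \<in> verts H" for x
    using that inj vF by (simp add: t_def)
  have "(?g x, ?g y) \<in> arcs_ends F \<longleftrightarrow> (x, y) \<in> arcs_ends H" if "x \<in> verts H" "y \<in> verts H" for x y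
  proof -
    have "x = u \<and> y = v" if "(u, v) \<in> arcs_ends H" "?g x = ?g u" "?g y = ?g v" for u v
      using that \<open>x \<in> verts H\<close> \<open>y \<in> verts H\<close> inj wf_digraph.adj_in_verts[OF assms(1) that(1)]
      by (auto dest: inj_onD)
    then show ?thesis by (force simp: aF)
  qed
  moreover have "bij_betw t (verts F) (verts H)"
    unfolding t_def using bij_betw_inv_into[OF g] by (simp add: bij_betw_def)
  ultimately have "t \<in> isomorphisms F H"
    using tg by (auto simp: isomorphisms_def t_def vF)
  then show ?thesis by blast
qed

text \<open>Each arc of \<open>H\<close> is sent to an arc of \<open>F\<close> with the
  corresponding ends; the absence of parallel arcs makes this choice injective and
  surjective.\<close>

lemma isomorphisms_imp_digraph_iso:
  assumes "wf_digraph H" "nomulti_digraph H" "wf_digraph F" "nomulti_digraph F"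
    and "t \<in> isomorphisms F H"
  shows "digraph_iso H F"
proof -
  interpret H: nomulti_digraph H by fact
  interpret F: nomulti_digraph F by fact
  have t: "bij_betw t (verts F) (verts H)"
    and arc: "\<And>x y. x \<in> verts F \<Longrightarrow> y \<in> verts F \<Longrightarrow> (x, y) \<in> arcs_ends F \<longleftrightarrow> (t x, t y) \<in> arcs_ends H"
    using assms(5) by (auto simp: isomorphisms_def)
  define g where "g = inv_into (verts F) t"
  have g: "bij_betw g (verts H) (verts F)" unfolding g_def using t by (rule bij_betw_inv_into)
  have tg: "t (g x) = x" if "x \<in> verts H" for x
    using that t by (simp add: g_def bij_betw_inv_into_right)
  have gt: "g (t x) = x" if "x \<in> verts F" for x
    using that t by (simp add: g_def bij_betw_inv_into_left)
  have gV: "g x \<in> verts F" if "x \<in> verts H" for x using that g by (auto simp: bij_betw_def)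
  have tV: "t x \<in> verts H" if "x \<in> verts F" for x using that t by (auto simp: bij_betw_def)
  have "\<exists>b\<in>arcs F. tail F b = g (tail H a) \<and> head F b = g (head H a)" if a: "a \<in> arcs H" for a
  proof -
    have "(tail H a, head H a) \<in> arcs_ends H" using a by (auto simp: arcs_ends_conv)
    then have "(g (tail H a), g (head H a)) \<in> arcs_ends F"
      using a arc[of "g (tail H a)" "g (head H a)"] tg gV by simp
    then show ?thesis by (auto simp: arcs_ends_conv)
  qed
  then obtain k where k: "\<And>a. a \<in> arcs H \<Longrightarrow> k a \<in> arcs F \<and> tail F (k a) = g (tail H a) \<and> head F (k a) = g (head H a)"
    by metis
  have k_inj: "inj_on k (arcs H)"
  proof (rule inj_onI)
    fix a b assume a: "a \<in> arcs H" and b: "b \<in> arcs H" and "k a = k b"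
    then have "g (tail H a) = g (tail H b)" "g (head H a) = g (head H b)" using k by metis+
    then have "tail H a = tail H b" "head H a = head H b"
      using tg a b by (metis H.tail_in_verts, metis H.head_in_verts)
    then show "a = b" using a b by (intro H.no_multi_arcs) (simp_all add: arc_to_ends_def)
  qed
  have k_surj: "b \<in> k ` arcs H" if b: "b \<in> arcs F" for b
  proof -
    have "(tail F b, head F b) \<in> arcs_ends F" using b by (auto simp: arcs_ends_conv)
    then have "(t (tail F b), t (head F b)) \<in> arcs_ends H"
      using arc[of "tail F b" "head F b"] b by simp
    then obtain a where a: "a \<in> arcs H" "tail H a = t (tail F b)" "head H a = t (head F b)"
      by (auto simp: arcs_ends_conv)
    then have "k a = b"
      using k[OF a(1)] b gt by (intro F.no_multi_arcs) (simp_all add: arc_to_ends_def)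
    then show ?thesis using a by blast
  qed
  define f where "f = \<lparr>iso_verts = g, iso_arcs = k, iso_head = head F, iso_tail = tail F\<rparr>"
  have "pre_digraph.digraph_isomorphism H f"
    unfolding pre_digraph.digraph_isomorphism_def using assms(1) g k k_inj
    by (simp add: f_def bij_betw_def)
  moreover have "F = app_iso f H"
    using g k k_surj by (intro pre_digraph.equality) (auto simp: f_def bij_betw_def)
  ultimately show ?thesis by (auto simp: digraph_iso_def)
qed

text \<open>Composition with \<open>s\<close> is a bijection from the automorphisms of
  \<open>F\<close> to the isomorphisms onto \<open>H\<close>.\<close>

lemma card_isomorphisms_eq:
  assumes s: "s \<in> isomorphisms F H"
  shows "card (isomorphisms F H) = card (isomorphisms F F)"
proof (rule bij_betw_same_card[symmetric])
  let ?V = "verts F"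
  have sb: "bij_betw s ?V (verts H)"
    and sa: "\<And>x y. x \<in> ?V \<Longrightarrow> y \<in> ?V \<Longrightarrow> (x, y) \<in> arcs_ends F \<longleftrightarrow> (s x, s y) \<in> arcs_ends H"
    using s by (auto simp: isomorphisms_def)
  let ?i = "inv_into ?V s"
  have ib: "bij_betw ?i (verts H) ?V" using sb by (rule bij_betw_inv_into)
  have si: "s (?i x) = x" if "x \<in> verts H" for x using that sb by (simp add: bij_betw_inv_into_right)
  have iss: "?i (s x) = x" if "x \<in> ?V" for x using that sb by (simp add: bij_betw_inv_into_left)
  show "bij_betw (\<lambda>t. restrict (s \<circ> t) ?V) (isomorphisms F F) (isomorphisms F H)"
  proof (rule bij_betwI[where g = "\<lambda>t. restrict (?i \<circ> t) ?V"])
    show "(\<lambda>t. restrict (s \<circ> t) ?V) \<in> isomorphisms F F \<rightarrow> isomorphisms F H"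
    proof
      fix t assume "t \<in> isomorphisms F F"
      then have tb: "bij_betw t ?V ?V"
        and ta: "\<And>x y. x \<in> ?V \<Longrightarrow> y \<in> ?V \<Longrightarrow> (x, y) \<in> arcs_ends F \<longleftrightarrow> (t x, t y) \<in> arcs_ends F"
        by (auto simp: isomorphisms_def)
      have "bij_betw (restrict (s \<circ> t) ?V) ?V (verts H)"
        using bij_betw_trans[OF tb sb] by (simp cong: bij_betw_cong)
      moreover have "(x, y) \<in> arcs_ends F \<longleftrightarrow> (s (t x), s (t y)) \<in> arcs_ends H"
        if "x \<in> ?V" "y \<in> ?V" for x y
        using ta[OF that] sa[of "t x" "t y"] that tb by (simp add: bij_betw_apply)
      ultimately show "restrict (s \<circ> t) ?V \<in> isomorphisms F H"
        by (simp add: isomorphisms_def)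
    qed
    show "(\<lambda>t. restrict (?i \<circ> t) ?V) \<in> isomorphisms F H \<rightarrow> isomorphisms F F"
    proof
      fix t assume "t \<in> isomorphisms F H"
      then have tb: "bij_betw t ?V (verts H)"
        and ta: "\<And>x y. x \<in> ?V \<Longrightarrow> y \<in> ?V \<Longrightarrow> (x, y) \<in> arcs_ends F \<longleftrightarrow> (t x, t y) \<in> arcs_ends H"
        by (auto simp: isomorphisms_def)
      have "bij_betw (restrict (?i \<circ> t) ?V) ?V ?V"
        using bij_betw_trans[OF tb ib] by (simp cong: bij_betw_cong)
      moreover have "(x, y) \<in> arcs_ends F \<longleftrightarrow> (?i (t x), ?i (t y)) \<in> arcs_ends F"
        if "x \<in> ?V" "y \<in> ?V" for x y
      proof -
        have "t x \<in> verts H" "t y \<in> verts H" using that tb by (auto simp: bij_betw_def)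
        then show ?thesis
          using ta[OF that] sa[of "?i (t x)" "?i (t y)"] si ib by (simp add: bij_betw_apply)
      qed
      ultimately show "restrict (?i \<circ> t) ?V \<in> isomorphisms F F"
        by (simp add: isomorphisms_def)
    qed
    show "restrict (?i \<circ> restrict (s \<circ> t) ?V) ?V = t" if "t \<in> isomorphisms F F" for t
    proof (rule extensionalityI[of _ ?V])
      fix x assume "x \<in> ?V"
      moreover then have "t x \<in> ?V" using that by (auto simp: isomorphisms_def bij_betw_def)
      ultimately show "restrict (?i \<circ> restrict (s \<circ> t) ?V) ?V x = t x" by (simp add: iss)
    qed (use that in \<open>simp_all add: isomorphisms_def\<close>)
    show "restrict (s \<circ> restrict (?i \<circ> t) ?V) ?V = t" if "t \<in> isomorphisms F H" for t
    proof (rule extensionalityI[of _ ?V])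
      fix x assume x: "x \<in> ?V"
      then have "t x \<in> verts H" using that by (auto simp: isomorphisms_def bij_betw_def)
      moreover then have "?i (t x) \<in> ?V" using ib by (simp add: bij_betw_apply)
      ultimately show "restrict (s \<circ> restrict (?i \<circ> t) ?V) ?V x = t x" using x by (simp add: si)
    qed (use that in \<open>simp_all add: isomorphisms_def\<close>)
  qed
qed

lemma card_isomorphisms_pos:
  assumes "finite (verts F)"
  shows "card (isomorphisms F F) > 0"
proof -
  have sub: "isomorphisms F F \<subseteq> PiE (verts F) (\<lambda>_. verts F)"
    by (rule subsetI) (auto simp: isomorphisms_def bij_betw_def PiE_def)
  have "finite (isomorphisms F F)" by (rule finite_subset[OF sub]) (simp add: finite_PiE assms)
  moreover have "bij_betw (\<lambda>x\<in>verts F. x) (verts F) (verts F)"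
    by (simp add: bij_betw_def inj_on_def)
  then have "(\<lambda>x\<in>verts F. x) \<in> isomorphisms F F" by (simp add: isomorphisms_def)
  ultimately show ?thesis by (auto simp: card_gt_0_iff)
qed

text \<open>A subgraph inherits the ends of its arcs from \<open>G\<close>, where no two arcs share
  both ends.\<close>

lemma subgraph_eqI:
  assumes "nomulti_digraph G" "subgraph H G" "subgraph K G"
    and "verts H = verts K" and ends: "arcs_ends H = arcs_ends K"
  shows "H = K"
proof (rule pre_digraph.equality)
  interpret G: nomulti_digraph G by fact
  have H: "arcs H \<subseteq> arcs G" "tail H = tail G" "head H = head G"
    and K: "arcs K \<subseteq> arcs G" "tail K = tail G" "head K = head G"
    using assms(2,3) by (auto simp: subgraph_def compatible_def)
  have "arc_to_ends H = arc_to_ends G" "arc_to_ends K = arc_to_ends G"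
    using H K by (auto simp: arc_to_ends_def fun_eq_iff)
  then have "arc_to_ends G ` arcs H = arc_to_ends G ` arcs K"
    using ends by (simp add: arcs_ends_def)
  then show "arcs H = arcs K"
    using inj_on_image_eq_iff[OF G.inj_on_arc_to_ends H(1) K(1)] by simp
  show "tail H = tail K" "head H = head K" using H K by simp_all
qed (use assms(4) in simp_all)

text \<open>The copy of \<open>F\<close> that an embedding \<open>t\<close> cuts out of
  \<open>G\<close>. It has all the vertices of \<open>G\<close>, since an embedding is onto.\<close>

definition image_subgraph :: "('a, 'b) pre_digraph \<Rightarrow> ('e, 'f) pre_digraph \<Rightarrow> ('e \<Rightarrow> 'a) \<Rightarrow> ('a, 'b) pre_digraph" where
  "image_subgraph G F t = \<lparr>verts = verts G,
     arcs = {a \<in> arcs G. (tail G a, head G a) \<in> (\<lambda>(x, y). (t x, t y)) ` arcs_ends F},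
     tail = tail G, head = head G\<rparr>"

lemma image_subgraph:
  assumes G: "graph G" and F: "graph F" and t: "t \<in> embeddings F G"
  shows "subgraph (image_subgraph G F t) G" "graph (image_subgraph G F t)"
    "t \<in> isomorphisms F (image_subgraph G F t)"
proof -
  interpret G: graph G by fact
  interpret F: graph F by fact
  let ?H = "image_subgraph G F t"
  have tb: "bij_betw t (verts F) (verts G)" and t_ext: "t \<in> extensional (verts F)"
    and ta: "\<And>x y. (x, y) \<in> arcs_ends F \<Longrightarrow> (t x, t y) \<in> arcs_ends G"
    using t F.adj_in_verts by (auto simp: embeddings_def)
  have ends: "arcs_ends ?H = (\<lambda>(x, y). (t x, t y)) ` arcs_ends F"
  proof -
    have "arcs_ends ?H = arcs_ends G \<inter> (\<lambda>(x, y). (t x, t y)) ` arcs_ends F"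
      unfolding arcs_ends_def arc_to_ends_def image_subgraph_def by (simp, blast)
    moreover have "(\<lambda>(x, y). (t x, t y)) ` arcs_ends F \<subseteq> arcs_ends G" using ta by auto
    ultimately show ?thesis by blast
  qed
  have "wf_digraph ?H" by unfold_locales (auto simp: image_subgraph_def)
  then show sub: "subgraph ?H G"
    by (auto simp: subgraph_def image_subgraph_def compatible_def G.wf_digraph)
  have "symmetric ?H"
    unfolding symmetric_def ends using F.graph_symmetric by (auto intro!: symI)
  then show "graph ?H" using digraph.graphI[OF G.digraph_subgraph[OF sub]] by blast
  have "(x, y) \<in> arcs_ends F \<longleftrightarrow> (t x, t y) \<in> arcs_ends ?H" if "x \<in> verts F" "y \<in> verts F" for x y
  proof
    assume "(t x, t y) \<in> arcs_ends ?H"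
    then obtain u v where uv: "(u, v) \<in> arcs_ends F" "t x = t u" "t y = t v"
      unfolding ends by auto
    then have "x = u" "y = v"
      using that tb F.adj_in_verts[OF uv(1)] by (auto simp: bij_betw_def dest: inj_onD)
    then show "(x, y) \<in> arcs_ends F" using uv by simp
  qed (auto simp: ends)
  then show "t \<in> isomorphisms F ?H"
    using tb t_ext by (simp add: isomorphisms_def image_subgraph_def)
qed

text \<open>Each embedding is an isomorphism onto exactly one subgraph of \<open>G\<close>, and each
  copy of \<open>F\<close> is reached by as many embeddings as \<open>F\<close> has
  automorphisms.\<close>

lemma card_embeddings:
  assumes G: "graph G" and F: "graph F" and card: "card (verts F) = card (verts G)"
  shows "card (embeddings F G) = subgraph_count G F * card (isomorphisms F F)"
proof -
  interpret G: graph G by fact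
  interpret F: graph F by fact
  let ?S = "{H. subgraph H G \<and> graph H \<and> digraph_iso H F}"
  have iso: "isomorphisms F H \<noteq> {}" if "H \<in> ?S" for H
    using that by (intro digraph_iso_imp_isomorphisms) (auto simp: subgraph_def)
  \<comment> \<open>Equal numbers of vertices force a copy of \<open>F\<close> to contain every
    vertex of \<open>G\<close>.\<close>
  have spanning: "verts H = verts G" if H: "H \<in> ?S" for H
  proof -
    obtain s where "bij_betw s (verts F) (verts H)" using iso[OF H] by (auto simp: isomorphisms_def)
    then have "card (verts H) = card (verts G)" using card bij_betw_same_card by metis
    then show ?thesis using H by (intro card_subset_eq) (auto simp: subgraph_def)
  qed
  have "embeddings F G = (\<Union>H\<in>?S. isomorphisms F H)"
  proof (rule Set.set_eqI, rule iffI)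
    fix t assume t: "t \<in> embeddings F G"
    have "digraph_iso (image_subgraph G F t) F"
    proof (rule isomorphisms_imp_digraph_iso[OF _ _ _ _ image_subgraph(3)[OF G F t]])
      interpret H: graph "image_subgraph G F t" by (rule image_subgraph(2)[OF G F t])
      show "wf_digraph (image_subgraph G F t)" "nomulti_digraph (image_subgraph G F t)"
        by unfold_locales
    qed unfold_locales
    then have "image_subgraph G F t \<in> ?S" using image_subgraph(1,2)[OF G F t] by simp
    then show "t \<in> (\<Union>H\<in>?S. isomorphisms F H)" using image_subgraph(3)[OF G F t] by blast
  next
    fix t assume "t \<in> (\<Union>H\<in>?S. isomorphisms F H)"
    then obtain H where H: "H \<in> ?S" "t \<in> isomorphisms F H" by blast
    then have "arcs_ends H \<subseteq> arcs_ends G" by (simp add: arcs_ends_mono)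
    then show "t \<in> embeddings F G" using H(2) spanning[OF H(1)]
      by (auto simp: isomorphisms_def embeddings_def)
  qed
  moreover have "finite ?S"
  proof (rule finite_subset)
    show "?S \<subseteq> (\<lambda>(V, E). \<lparr>verts = V, arcs = E, tail = tail G, head = head G\<rparr>)
        ` (Pow (verts G) \<times> Pow (arcs G))"
    proof
      fix H assume "H \<in> ?S"
      then have H: "verts H \<subseteq> verts G" "arcs H \<subseteq> arcs G" "tail H = tail G" "head H = head G"
        by (auto simp: subgraph_def compatible_def)
      then have "H = (\<lambda>(V, E). \<lparr>verts = V, arcs = E, tail = tail G, head = head G\<rparr>) (verts H, arcs H)"
        by simp
      then show "H \<in> (\<lambda>(V, E). \<lparr>verts = V, arcs = E, tail = tail G, head = head G\<rparr>)
        ` (Pow (verts G) \<times> Pow (arcs G))" using H by blast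
    qed
  qed simp
  moreover have "finite (isomorphisms F H)" if "H \<in> ?S" for H
    using iso[OF that] card_isomorphisms_eq[of _ F H] card_isomorphisms_pos[OF F.finite_verts]
    by (metis all_not_in_conv card_gt_0_iff)
  \<comment> \<open>An isomorphism determines its target: the vertices and the edges are the images
    of those of \<open>F\<close>.\<close>
  moreover have "isomorphisms F H \<inter> isomorphisms F K = {}" if "H \<in> ?S" "K \<in> ?S" "H \<noteq> K" for H K
  proof (rule ccontr)
    assume "isomorphisms F H \<inter> isomorphisms F K \<noteq> {}"
    then obtain t where t: "t \<in> isomorphisms F H" "t \<in> isomorphisms F K" by blast
    have V: "verts H = verts K" using that spanning by simp
    have im: "t ` verts F = verts H" using t by (simp add: isomorphisms_def bij_betw_def)
    have "(u, v) \<in> arcs_ends H \<longleftrightarrow> (u, v) \<in> arcs_ends K" for u v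
    proof (cases "u \<in> verts H \<and> v \<in> verts H")
      case True
      then obtain x y where "x \<in> verts F" "y \<in> verts F" "u = t x" "v = t y" using im by blast
      then show ?thesis using t by (simp add: isomorphisms_def)
    next
      case False
      have "wf_digraph H" "wf_digraph K" using that by (auto simp: subgraph_def)
      then show ?thesis using False V by (metis wf_digraph.adj_in_verts)
    qed
    then have "arcs_ends H = arcs_ends K" by (auto simp: set_eq_iff)
    then have "H = K" using that V by (intro subgraph_eqI[of G]) (simp_all add: G.nomulti_digraph)
    then show False using that by simp
  qed
  ultimately have "card (embeddings F G) = (\<Sum>H\<in>?S. card (isomorphisms F H))"
    by (simp add: card_UN_disjoint)
  also have "\<dots> = (\<Sum>H\<in>?S. card (isomorphisms F F))"
  proof (rule sum.cong[OF refl])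
    fix H assume "H \<in> ?S"
    then obtain s where "s \<in> isomorphisms F H" using iso by blast
    then show "card (isomorphisms F H) = card (isomorphisms F F)" by (rule card_isomorphisms_eq)
  qed
  finally show ?thesis by (simp add: subgraph_count_def)
qed

section \<open>Elementary graphs\<close>

text \<open>Both directions of each edge are listed. On an orbit of size 2 the two lists coincide
  and give a single undirected edge.\<close>

definition perm_arcs :: "'a set \<Rightarrow> ('a \<Rightarrow> 'a) \<Rightarrow> ('a \<times> 'a) set" where
  "perm_arcs V p = (\<lambda>x. (x, p x)) ` V \<union> (\<lambda>x. (p x, x)) ` V"

lemma cycle_graph_perm:
  assumes "cycle_graph r C"
  obtains p where "bij_betw p (verts C) (verts C)" and "arcs_ends C = perm_arcs (verts C) p"
proof -
  obtain f where f: "bij_betw f {..<r} (verts C)"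
    and E: "arcs_ends C = (\<Union>i<r. {(f i, f (Suc i mod r)), (f (Suc i mod r), f i)})"
    and r: "r > 2"
    using assms by (auto simp: cycle_graph_def)
  let ?s = "\<lambda>i. Suc i mod r"
  let ?g = "inv_into {..<r} f"
  have "?s ` {..<r} = {..<r}"
  proof
    show "{..<r} \<subseteq> ?s ` {..<r}"
    proof
      fix i assume i: "i \<in> {..<r}"
      show "i \<in> ?s ` {..<r}"
      proof (cases i)
        case 0
        then show ?thesis using r by (intro image_eqI[of _ _ "r - 1"]) auto
      next
        case (Suc j)
        then show ?thesis using i by (intro image_eqI[of _ _ j]) auto
      qed
    qed
  qed (use r in auto)
  then have s: "bij_betw ?s {..<r} {..<r}" by (simp add: bij_betw_def finite_surj_inj)
  \<comment> \<open>\<open>p\<close> rotates the cycle by one index, carried to the vertices by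
    \<open>f\<close>.\<close>
  define p where "p = f \<circ> (?s \<circ> ?g)"
  have "bij_betw p (verts C) (verts C)"
    unfolding p_def by (intro bij_betw_trans[OF _ f] bij_betw_trans[OF _ s] bij_betw_inv_into f)
  moreover have pf: "p (f i) = f (?s i)" if "i < r" for i
    using that f by (simp add: p_def bij_betw_inv_into_left)
  have "arcs_ends C = perm_arcs (verts C) p"
  proof -
    have "verts C = f ` {..<r}" using f by (simp add: bij_betw_def)
    then have "perm_arcs (verts C) p = (\<lambda>i. (f i, p (f i))) ` {..<r} \<union> (\<lambda>i. (p (f i), f i)) ` {..<r}"
      by (simp add: perm_arcs_def image_image)
    also have "\<dots> = (\<lambda>i. (f i, f (?s i))) ` {..<r} \<union> (\<lambda>i. (f (?s i), f i)) ` {..<r}"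
      using pf by (intro arg_cong2[where f = "(\<union>)"] image_cong) auto
    also have "\<dots> = arcs_ends C" unfolding E by blast
    finally show ?thesis ..
  qed
  ultimately show ?thesis by (rule that)
qed

lemma complete_digraph_2_perm:
  assumes "complete_digraph 2 C"
  obtains p where "bij_betw p (verts C) (verts C)" and "arcs_ends C = perm_arcs (verts C) p"
proof -
  obtain a b where ab: "verts C = {a, b}" "a \<noteq> b"
    using assms by (auto simp: complete_digraph_def card_2_iff)
  let ?p = "Transposition.transpose a b"
  have E: "arcs_ends C = {(a, b), (b, a)}"
    using assms ab by (auto simp: complete_digraph_def)
  have "bij_betw ?p {a, b} {a, b}"
    by (intro permutes_imp_bij permutes_swap_id) auto
  moreover have "arcs_ends C = perm_arcs {a, b} ?p" by (auto simp: E perm_arcs_def)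
  ultimately show ?thesis using that[of ?p] ab by simp
qed

text \<open>Rotations of the cycles and swaps of the edges are glued to one permutation. If it had a
  single orbit, \<open>F\<close> would be connected, hence a component of itself: an edge or a
  cycle, excluded by the size and by \<open>not_cycle\<close>.\<close>

lemma elementary_graph_perm:
  assumes F: "elementary_graph F" and card: "card (verts F) \<ge> 3"
    and not_cycle: "\<not> (\<exists>r. cycle_graph r F)"
  obtains p where "p permutes verts F" and "arcs_ends F = perm_arcs (verts F) p"
    and "card (orbits (verts F) p) \<ge> 2"
proof -
  interpret F: graph F using F by (simp add: elementary_graph_def)
  let ?V = "verts F"
  let ?C = "\<lambda>x. F \<restriction> F.scc_of x"
  have scc: "?C x \<in> F.sccs" if "x \<in> ?V" for x
    using that F.scc_of_in_sccs_verts F.in_verts_sccsD_sccs by blast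
  have self: "x \<in> F.scc_of x" if "x \<in> ?V" for x using that by (rule F.in_scc_of_self)
  have sub: "F.scc_of x \<subseteq> ?V" for x by (auto simp: F.scc_of_def F.reachable_in_verts)
  have same: "F.scc_of y = F.scc_of x" if "y \<in> F.scc_of x" for x y
    using that by (auto simp: F.scc_of_def intro: F.reachable_trans)
  have "\<exists>p. bij_betw p (verts C) (verts C) \<and> arcs_ends C = perm_arcs (verts C) p" if "C \<in> F.sccs" for C
  proof -
    have "complete_digraph 2 C \<or> (\<exists>r. cycle_graph r C)"
      using F that by (auto simp: elementary_graph_def)
    then show ?thesis using complete_digraph_2_perm[of C] cycle_graph_perm[of _ C] by metis
  qed
  then obtain q where q: "\<And>C. C \<in> F.sccs \<Longrightarrow> bij_betw (q C) (verts C) (verts C)"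
    "\<And>C. C \<in> F.sccs \<Longrightarrow> arcs_ends C = perm_arcs (verts C) (q C)" by metis
  define p where "p x = (if x \<in> ?V then q (?C x) x else x)" for x
  have p_eq: "p y = q (?C x) y" if "x \<in> ?V" "y \<in> F.scc_of x" for x y
    using that sub same by (auto simp: p_def)
  have im: "p ` F.scc_of x = F.scc_of x" if "x \<in> ?V" for x
  proof -
    have "p ` F.scc_of x = q (?C x) ` F.scc_of x" using p_eq[OF that] by (intro image_cong) auto
    then show ?thesis using q(1)[OF scc[OF that]] by (simp add: bij_betw_def)
  qed
  have "p ` ?V = ?V"
  proof
    show "p ` ?V \<subseteq> ?V" using im self sub by blast
    show "?V \<subseteq> p ` ?V" using im self sub by blast
  qed
  then have "bij_betw p ?V ?V" by (simp add: bij_betw_def finite_surj_inj)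
  then have p: "p permutes ?V" by (rule bij_imp_permutes) (simp add: p_def)
  have E: "arcs_ends F = perm_arcs ?V p"
  proof
    show "arcs_ends F \<subseteq> perm_arcs ?V p"
    proof (rule subrelI)
      fix x y assume xy: "(x, y) \<in> arcs_ends F"
      then have x: "x \<in> ?V" by (rule F.adj_in_verts)
      \<comment> \<open>An edge can be traversed both ways, so its ends lie in one
        component.\<close>
      have "y \<in> F.scc_of x" using xy F.graph_symmetric by (auto simp: F.scc_of_def)
      then have "(x, y) \<in> arcs_ends (?C x)"
        using xy self[OF x] by (auto simp: arcs_ends_conv)
      then have "(x, y) \<in> perm_arcs (F.scc_of x) (q (?C x))" using q(2)[OF scc[OF x]] by simp
      also have "perm_arcs (F.scc_of x) (q (?C x)) = perm_arcs (F.scc_of x) p"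
        unfolding perm_arcs_def using p_eq[OF x] by auto
      also have "\<dots> \<subseteq> perm_arcs ?V p" using sub by (auto simp: perm_arcs_def)
      finally show "(x, y) \<in> perm_arcs ?V p" .
    qed
    have "(x, p x) \<in> arcs_ends F" if x: "x \<in> ?V" for x
    proof -
      have "(x, p x) \<in> arcs_ends (?C x)"
        using q(2)[OF scc[OF x]] self[OF x] p_eq[OF x self[OF x]] by (auto simp: perm_arcs_def)
      then show ?thesis by (auto simp: arcs_ends_conv)
    qed
    then show "perm_arcs ?V p \<subseteq> arcs_ends F"
      using F.graph_symmetric by (auto simp: perm_arcs_def)
  qed
  have "card (orbits ?V p) \<ge> 2"
  proof (rule ccontr)
    assume "\<not> card (orbits ?V p) \<ge> 2"
    then have one: "card (orbits ?V p) \<le> Suc 0" by simp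
    have fin: "finite (orbits ?V p)" by (simp add: orbits_def)
    have "u \<rightarrow>\<^sup>*\<^bsub>F\<^esub> v" if u: "u \<in> ?V" and v: "v \<in> ?V" for u v
    proof -
      have "orbit p u = orbit p v"
        using one u v unfolding card_le_Suc0_iff_eq[OF fin] unfolding orbits_def by blast
      then have "v \<in> orbit p u" using self_in_orbit[OF F.finite_verts p] by simp
      then show ?thesis
      proof induction
        case base
        have "(u, p u) \<in> arcs_ends F" using u by (simp add: E perm_arcs_def)
        then show ?case by simp
      next
        case (step y)
        then have "y \<in> ?V" by (auto dest: F.reachable_in_verts)
        then have "(y, p y) \<in> arcs_ends F" by (simp add: E perm_arcs_def)
        with step.IH show ?case by (rule F.reachable_adj_trans)
      qed
    qed
    moreover have "?V \<noteq> {}" using card by auto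
    ultimately have "strongly_connected F" by (intro strongly_connectedI)
    then have "F \<in> F.sccs" by (simp add: F.strongly_connected_eq_iff)
    then have "complete_digraph 2 F" using F not_cycle by (auto simp: elementary_graph_def)
    then show False using card by (simp add: complete_digraph_def)
  qed
  then show ?thesis using that p E by blast
qed

text \<open>A product of 0-1 entries is 1 exactly when all its pairs are edges. So the sum counts
  the permutations \<open>t\<close> for which \<open>k \<circ> t\<close>, restricted to
  \<open>verts F\<close>, is an embedding, and each embedding arises from exactly one
  \<open>t\<close>.\<close>

lemma conj_sum_eq_card_embeddings:
  assumes F: "graph F" and G: "graph G" and k: "bij_betw k (verts F) (verts G)"
    and p: "p permutes verts F" and E: "arcs_ends F = perm_arcs (verts F) p"
  shows "conj_sum (\<lambda>x y. adj G (k x) (k y)) (verts F) p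
    = int (card (embeddings F G))"
proof -
  interpret F: graph F by fact
  interpret G: graph G by fact
  let ?V = "verts F"
  let ?A = "\<lambda>x y. adj G (k x) (k y)"
  let ?T = "{t. t permutes ?V \<and> (\<forall>x\<in>?V. (k (t x), k (t (p x))) \<in> arcs_ends G)}"
  let ?i = "inv_into ?V k"
  have emb: "embeddings F G = {f \<in> extensional ?V. bij_betw f ?V (verts G) \<and>
      (\<forall>x\<in>?V. (f x, f (p x)) \<in> arcs_ends G)}"
  proof -
    have "(\<forall>x\<in>?V. \<forall>y\<in>?V. (x, y) \<in> arcs_ends F \<longrightarrow> (f x, f y) \<in> arcs_ends G)
      \<longleftrightarrow> (\<forall>x\<in>?V. (f x, f (p x)) \<in> arcs_ends G)" for f
      using G.graph_symmetric permutes_in_image[OF p] unfolding E perm_arcs_def by blast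
    then show ?thesis by (simp add: embeddings_def)
  qed
  have ib: "bij_betw ?i (verts G) ?V" using k by (rule bij_betw_inv_into)
  have ik: "?i (k x) = x" if "x \<in> ?V" for x using that k by (simp add: bij_betw_inv_into_left)
  have ki: "k (?i x) = x" if "x \<in> verts G" for x using that k by (simp add: bij_betw_inv_into_right)
  have "conj_sum ?A ?V p = (\<Sum>t | t permutes ?V. if \<forall>x\<in>?V. (k (t x), k (t (p x))) \<in> arcs_ends G then 1 else 0)"
    unfolding conj_sum_def
  proof (rule sum.cong[OF refl])
    fix t assume "t \<in> {t. t permutes ?V}"
    then have "perm_weight ?A ?V (t \<circ> p \<circ> inv_into UNIV t) = (\<Prod>x\<in>?V. ?A (t x) (t (p x)))"
      using perm_weight_conj[of t ?V ?A p] by simp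
    also have "\<dots> = (if \<forall>x\<in>?V. (k (t x), k (t (p x))) \<in> arcs_ends G then 1 else 0)"
      by (auto simp: adj_def intro: prod_zero)
    finally show "perm_weight ?A ?V (t \<circ> p \<circ> inv_into UNIV t)
      = (if \<forall>x\<in>?V. (k (t x), k (t (p x))) \<in> arcs_ends G then 1 else 0)" .
  qed
  also have "\<dots> = int (card ?T)"
    by (simp add: finite_permutations flip: sum.inter_filter)
  also have "card ?T = card (embeddings F G)"
  proof (rule bij_betw_same_card)
    show "bij_betw (\<lambda>t. restrict (k \<circ> t) ?V) ?T (embeddings F G)"
    \<comment> \<open>\<open>restrict_id\<close> extends by the identity, as a permutation requires,
      and \<open>restrict\<close> by the undefined value, as an extensional map requires.\<close>
    proof (rule bij_betwI[where g = "\<lambda>f. restrict_id (?i \<circ> f) ?V"])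
      show "(\<lambda>t. restrict (k \<circ> t) ?V) \<in> ?T \<rightarrow> embeddings F G"
      proof
        fix t assume t: "t \<in> ?T"
        then have "bij_betw t ?V ?V" by (auto intro: permutes_imp_bij)
        then have "bij_betw (restrict (k \<circ> t) ?V) ?V (verts G)"
          using bij_betw_trans[OF _ k] by (simp cong: bij_betw_cong)
        then show "restrict (k \<circ> t) ?V \<in> embeddings F G"
          using t permutes_in_image[OF p] by (simp add: emb)
      qed
      show "(\<lambda>f. restrict_id (?i \<circ> f) ?V) \<in> embeddings F G \<rightarrow> ?T"
      proof
        fix f assume f: "f \<in> embeddings F G"
        then have fb: "bij_betw f ?V (verts G)" by (simp add: emb)
        then have "restrict_id (?i \<circ> f) ?V permutes ?V"
          by (intro permutes_restrict_id bij_betw_trans[OF _ ib])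
        moreover have "f x \<in> verts G" if "x \<in> ?V" for x using that fb by (rule bij_betw_apply[rotated])
        ultimately show "restrict_id (?i \<circ> f) ?V \<in> ?T"
          using f permutes_in_image[OF p] by (simp add: emb ki)
      qed
      fix t assume t: "t \<in> ?T"
      show "restrict_id (?i \<circ> restrict (k \<circ> t) ?V) ?V = t"
      proof
        fix x
        show "restrict_id (?i \<circ> restrict (k \<circ> t) ?V) ?V x = t x"
          using t ik[of "t x"] permutes_in_image[of t ?V x] permutes_not_in[of t ?V x]
          by (cases "x \<in> ?V") auto
      qed
    next
      fix f assume f: "f \<in> embeddings F G"
      show "restrict (k \<circ> restrict_id (?i \<circ> f) ?V) ?V = f"
      proof (rule extensionalityI[of _ ?V])
        fix x assume "x \<in> ?V"
        moreover then have "f x \<in> verts G" using f by (auto simp: emb bij_betw_def)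
        ultimately show "restrict (k \<circ> restrict_id (?i \<circ> f) ?V) ?V x = f x" by (simp add: ki)
      qed (use f in \<open>simp_all add: emb\<close>)
    qed
  qed
  finally show ?thesis .
qed

section \<open>Reconstruction\<close>

lemma zero_one_symmetric_adj:
  assumes "graph G"
  shows "zero_one_symmetric (\<lambda>x y. adj G (k x) (k y)) W"
proof -
  interpret G: graph G by fact
  show ?thesis
    using G.graph_symmetric G.adj_not_same by (auto simp: zero_one_symmetric_def adj_def)
qed

lemma sum_adj_eq_out_degree:
  assumes "graph G"
  shows "(\<Sum>u\<in>verts G. adj G v u) = int (out_degree G v)"
proof -
  interpret G: graph G by fact
  have "inj_on (head G) (out_arcs G v)"
    by (rule inj_onI) (auto intro: G.no_multi_arcs simp: arc_to_ends_def)
  moreover have "head G ` out_arcs G v = {u \<in> verts G. (v, u) \<in> arcs_ends G}"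
    by (auto simp: arcs_ends_conv)
  ultimately have "out_degree G v = card {u \<in> verts G. (v, u) \<in> arcs_ends G}"
    unfolding out_degree_def by (metis card_image)
  then show ?thesis
    unfolding adj_def by (simp flip: sum.inter_filter)
qed

text \<open>Both graphs are relabelled on \<open>verts F\<close>, where the permutation underlying
  \<open>F\<close> has equal conjugacy sums for both. These are the numbers of embeddings, and
  cancelling the number of automorphisms of \<open>F\<close> leaves the subgraph counts.\<close>

lemma subgraph_count_reconstructible:
  assumes G: "graph G" and G': "graph G'"
    and deck: "complete_poly_deck G' = complete_poly_deck G"
    and F: "elementary_graph F" "card (verts F) = card (verts G)" "\<not> (\<exists>r. cycle_graph r F)"
    and card: "card (verts G) \<ge> 3"
  shows "subgraph_count G' F = subgraph_count G F"
proof -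
  interpret G: graph G by fact
  interpret G': graph G' by fact
  have gF: "graph F" using F by (simp add: elementary_graph_def)
  interpret F: graph F by (rule gF)
  have card': "card (verts F) = card (verts G')"
    using card_verts_eq_of_deck[OF G.finite_verts G'.finite_verts deck] F(2) by simp
  obtain k where k: "bij_betw k (verts F) (verts G)"
    using F(2) by (meson F.finite_verts G.finite_verts finite_same_card_bij)
  obtain k' where k': "bij_betw k' (verts F) (verts G')"
    using card' by (meson F.finite_verts G'.finite_verts finite_same_card_bij)
  obtain p where p: "p permutes verts F" "arcs_ends F = perm_arcs (verts F) p"
    "card (orbits (verts F) p) \<ge> 2"
    using elementary_graph_perm[OF F(1) _ F(3)] F(2) card by metis
  have "int (card (embeddings F G)) = int (card (embeddings F G'))"
    using same_deck_conj_sum[OF same_deck_adj[OF F.finite_verts k k' deck] F.finite_verts p(1,3)]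
    unfolding conj_sum_eq_card_embeddings[OF gF G k p(1,2)]
      conj_sum_eq_card_embeddings[OF gF G' k' p(1,2)] .
  then show ?thesis
    using card_embeddings[OF G gF F(2)] card_embeddings[OF G' gF card']
      card_isomorphisms_pos[OF F.finite_verts] by simp
qed

text \<open>\<open>G'\<close> is relabelled on the vertices of \<open>G\<close>; row sums of the
  adjacency matrix are degrees, so a vertex of degree 1 is a leaf in the sense of
  \<open>pchar_poly_eq_of_leaf\<close>.\<close>

lemma graph_char_poly_reconstructible:
  assumes G: "graph G" and G': "graph G'"
    and deck: "complete_poly_deck G' = complete_poly_deck G"
    and card: "card (verts G) \<ge> 3" and leaf: "\<exists>v\<in>verts G. out_degree G v = 1"
  shows "graph_char_poly G' = graph_char_poly G"
proof -
  interpret G: graph G by fact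
  interpret G': graph G' by fact
  let ?V = "verts G"
  have "card (verts G') = card ?V"
    by (rule card_verts_eq_of_deck[OF G.finite_verts G'.finite_verts deck])
  then obtain k where k: "bij_betw k ?V (verts G')"
    by (metis G'.finite_verts G.finite_verts finite_same_card_bij)
  have "pchar_poly (adj G) ?V = pchar_poly (\<lambda>x y. adj G' (k x) (k y)) ?V"
  proof (rule pchar_poly_eq_of_leaf[OF _ G.finite_verts card])
    show "same_deck (adj G) (\<lambda>x y. adj G' (k x) (k y)) ?V"
      using same_deck_adj[OF G.finite_verts bij_betw_id k deck] by simp
    show "zero_one_symmetric (adj G) ?V"
      using zero_one_symmetric_adj[OF G, of id] by simp
    show "zero_one_symmetric (\<lambda>x y. adj G' (k x) (k y)) ?V"
      by (rule zero_one_symmetric_adj[OF G'])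
    show "\<exists>v\<in>?V. (\<Sum>u\<in>?V. adj G v u) = 1"
      using leaf by (simp add: sum_adj_eq_out_degree[OF G])
  qed
  then show ?thesis
    using pchar_poly_reindex[OF G.finite_verts k, of "adj G'"]
    by (simp add: graph_char_poly_eq_pchar_poly)
qed

theorem theorem4p4:
  fixes G :: "('a, 'b) pre_digraph"
  assumes "graph G" and "card (verts G) \<ge> 3"
  shows "(\<forall>F :: ('e, 'f) pre_digraph.
            elementary_graph F \<and> card (verts F) = card (verts G) \<and> \<not> (\<exists>r. cycle_graph r F) \<longrightarrow>
            (\<forall>G' :: ('c, 'd) pre_digraph.
               graph G' \<and> complete_poly_deck G' = complete_poly_deck G \<longrightarrow>
               subgraph_count G' F = subgraph_count G F)) \<and>
         ((\<exists>v \<in> verts G. out_degree G v = 1) \<longrightarrow>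
            (\<forall>G' :: ('c, 'd) pre_digraph.
               graph G' \<and> complete_poly_deck G' = complete_poly_deck G \<longrightarrow>
               graph_char_poly G' = graph_char_poly G))"
  using subgraph_count_reconstructible[OF assms(1)] graph_char_poly_reconstructible[OF assms(1)]
    assms(2) by blast

end
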